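(* Let $X$ be a complex Banach space and let $T\in B(X)$ be a Fredholm operator such that $0$ is an accumulation point of $\sigma(T)$. Suppose that for each $\lambda\in\sigma(T)\setminus\overline{\rho_{sf}^\pm(T)}$ and each $\epsilon>0$, the open ball $B(\lambda,\epsilon)$ contains a connected component of $\sigma_{sf}(T)\cup\pi_0(T)$. Then $\sigma$ is $\nu$-continuous at $T$, i.e. $\sigma(T_n)\to\sigma(T)$ in the Hausdorff metric for every sequence $(T_n)$ in $B(X)$ with $T_n\overset{\nu}{\to}T$.
   Context: $B(X)$ is the algebra of bounded linear operators on $X$. For $S\in B(X)$: $S$ is semi-Fredholm if $R(S)$ is closed and at least one of $\alpha(S)=\dim N(S)$, $\beta(S)=\dim X/R(S)$ is finite; it is Fredholm if both are finite; its index is $i(S)=\alpha(S)-\beta(S)\in\mathbb{Z}\cup\{\pm\infty\}$. $\sigma_{sf}(T)$ is the set of $\lambda$ with $T-\lambda$ not semi-Fredholm; $\rho_{sf}^\pm(T)$ is the set of $\lambda$ with $T-\lambda$ semi-Fredholm and $i(T-\lambda)\neq0$. $\pi_0(T)$ is the set of isolated points of $\sigma(T)$ that are eigenvalues of finite algebraic multiplicity. A sequence $T_n\in B(X)$ is $\nu$-convergent to $T$, $T_n\overset{\nu}{\to}T$, if $(\|T_n\|)$ is bounded, $\|(T_n-T)T\|\to0$ and $\|(T_n-T)T_n\|\to0$. *)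

theory Defs
  imports "HOL-Analysis.Analysis"
begin

class cbanach = banach +
  fixes scaleC :: "complex \<Rightarrow> 'a \<Rightarrow> 'a"
  assumes scaleC_add_right: "scaleC a (x + y) = scaleC a x + scaleC a y"
    and scaleC_add_left: "scaleC (a + b) x = scaleC a x + scaleC b x"
    and scaleC_scaleC: "scaleC a (scaleC b x) = scaleC (a * b) x"
    and scaleC_one: "scaleC 1 x = x"
    and scaleR_scaleC: "scaleR r x = scaleC (complex_of_real r) x"
    and norm_scaleC: "norm (scaleC a x) = cmod a * norm x"

lemma vector_space_scaleC: "vector_space (scaleC :: complex \<Rightarrow> 'a::cbanach \<Rightarrow> 'a)"
  by unfold_locales (simp_all add: scaleC_add_right scaleC_add_left scaleC_scaleC scaleC_one)

text \<open>Complex-linear bounded operators on X (the algebra B(X)); they are represented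
  by elements of the library type of bounded (real-)linear functions that
  additionally commute with complex scalars.\<close>

definition clinear_op :: "('a::cbanach \<Rightarrow>\<^sub>L 'a) \<Rightarrow> bool" where
  "clinear_op T \<longleftrightarrow> (\<forall>c x. blinfun_apply T (scaleC c x) = scaleC c (blinfun_apply T x))"

definition invertible_op :: "('a::cbanach \<Rightarrow> 'a) \<Rightarrow> bool" where
  "invertible_op S \<longleftrightarrow> (\<exists>R. bounded_linear R \<and> (\<forall>c x. R (scaleC c x) = scaleC c (R x))
        \<and> R \<circ> S = id \<and> S \<circ> R = id)"

definition shift_op :: "('a::cbanach \<Rightarrow>\<^sub>L 'a) \<Rightarrow> complex \<Rightarrow> 'a \<Rightarrow> 'a" where
  "shift_op T l = (\<lambda>x. blinfun_apply T x - scaleC l x)"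

definition spectrum_op :: "('a::cbanach \<Rightarrow>\<^sub>L 'a) \<Rightarrow> complex set" where
  "spectrum_op T = {l. \<not> invertible_op (shift_op T l)}"

abbreviation cspan :: "'a::cbanach set \<Rightarrow> 'a set" where
  "cspan \<equiv> module.span scaleC"

abbreviation cdim :: "'a::cbanach set \<Rightarrow> nat" where
  "cdim \<equiv> vector_space.dim scaleC"

definition dim_sub :: "'a::cbanach set \<Rightarrow> enat" where
  "dim_sub M = (if \<exists>B. finite B \<and> cspan B = M then enat (cdim M) else \<infinity>)"

text \<open>Codimension dim X/M of a subspace M (minimal number of vectors needed
  to complete M to a spanning set of X), \<infinity> if there is no finite such set.\<close>
definition codim_sub :: "'a::cbanach set \<Rightarrow> enat" where
  "codim_sub M = (INF F \<in> {F. finite F \<and> cspan (M \<union> F) = UNIV}. enat (card F))"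

definition kernel :: "('a \<Rightarrow> 'b::zero) \<Rightarrow> 'a set" where
  "kernel S = {x. S x = 0}"

definition nullity :: "('a::cbanach \<Rightarrow> 'a) \<Rightarrow> enat" where
  "nullity S = dim_sub (kernel S)"

definition defect :: "('a::cbanach \<Rightarrow> 'a) \<Rightarrow> enat" where
  "defect S = codim_sub (range S)"

definition semi_fredholm :: "('a::cbanach \<Rightarrow> 'a) \<Rightarrow> bool" where
  "semi_fredholm S \<longleftrightarrow> closed (range S) \<and> (nullity S \<noteq> \<infinity> \<or> defect S \<noteq> \<infinity>)"

definition fredholm :: "('a::cbanach \<Rightarrow> 'a) \<Rightarrow> bool" where
  "fredholm S \<longleftrightarrow> closed (range S) \<and> nullity S \<noteq> \<infinity> \<and> defect S \<noteq> \<infinity>"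

text \<open>Index with values in \<int> \<union> {\<plusminus>\<infinity>} (meaningful for semi-Fredholm S).\<close>
definition index_op :: "('a::cbanach \<Rightarrow> 'a) \<Rightarrow> ereal" where
  "index_op S = (if nullity S = \<infinity> then \<infinity> else if defect S = \<infinity> then -\<infinity>
     else ereal (real (the_enat (nullity S))) - ereal (real (the_enat (defect S))))"

definition sigma_sf :: "('a::cbanach \<Rightarrow>\<^sub>L 'a) \<Rightarrow> complex set" where
  "sigma_sf T = {l. \<not> semi_fredholm (shift_op T l)}"

definition rho_sf_pm :: "('a::cbanach \<Rightarrow>\<^sub>L 'a) \<Rightarrow> complex set" where
  "rho_sf_pm T = {l. semi_fredholm (shift_op T l) \<and> index_op (shift_op T l) \<noteq> 0}"

definition pi0 :: "('a::cbanach \<Rightarrow>\<^sub>L 'a) \<Rightarrow> complex set" where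
  "pi0 T = {l \<in> spectrum_op T. \<not> l islimpt spectrum_op T
      \<and> kernel (shift_op T l) \<noteq> {0}
      \<and> dim_sub (\<Union>n. kernel (shift_op T l ^^ n)) \<noteq> \<infinity>}"

definition nu_conv :: "(nat \<Rightarrow> ('a::cbanach \<Rightarrow>\<^sub>L 'a)) \<Rightarrow> ('a \<Rightarrow>\<^sub>L 'a) \<Rightarrow> bool" where
  "nu_conv Tn T \<longleftrightarrow> bounded (range (\<lambda>n. norm (Tn n)))
     \<and> (\<lambda>n. norm ((Tn n - T) o\<^sub>L T)) \<longlonglongrightarrow> 0
     \<and> (\<lambda>n. norm ((Tn n - T) o\<^sub>L Tn n)) \<longlonglongrightarrow> 0"

text \<open>Hausdorff distance between (nonempty bounded) sets.\<close>
definition hausdist :: "'a::metric_space set \<Rightarrow> 'a set \<Rightarrow> real" where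
  "hausdist A B = max (SUP a\<in>A. infdist a B) (SUP b\<in>B. infdist b A)"

end

theory Submission
  imports Defs "HOL-Complex_Analysis.Conformal_Mappings"
begin

text \<open>
  Write \<open>E\<^sub>n = T\<^sub>n - T\<close>. Away from \<open>0\<close> and from \<open>\<sigma>(T)\<close> the resolvents of \<open>T\<^sub>n\<close> are locally bounded
  uniformly in \<open>n\<close>, because \<open>(E\<^sub>n R)\<^sup>2 \<rightarrow> 0\<close> for \<open>R = (T - \<lambda>)\<^sup>-\<^sup>1\<close>; this is upper semicontinuity.

  For the lower half suppose that some ball \<open>B\<close> around a point of \<open>\<sigma>(T)\<close> misses \<open>\<sigma>(T\<^sub>n)\<close> for infinitely many
  \<open>n\<close>. Since \<open>R(T)\<close> is closed of finite codimension and \<open>E\<^sub>n T \<rightarrow> 0\<close>, we have \<open>E\<^sub>n = S\<^sub>n + F\<^sub>n\<close> with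
  \<open>S\<^sub>n \<rightarrow> 0\<close> in norm and \<open>F\<^sub>n\<close> of finite rank. So for \<open>\<lambda>\<close> in \<open>B\<close> the operator \<open>T - \<lambda>\<close> is a norm limit of
  operators of the form invertible plus finite rank, and if it is semi-Fredholm, it is itself of this form
  and has index \<open>0\<close>. Hence \<open>B\<close> does not meet \<open>\<rho>\<^sub>s\<^sub>f\<^sup>\<plusminus>(T)\<close>, and contains a component of
  \<open>\<sigma>\<^sub>s\<^sub>f(T) \<union> \<pi>\<^sub>0(T)\<close>. If that component contains a point of \<open>\<pi>\<^sub>0(T)\<close>, an eigenvector there contradicts
  the bound on \<open>(T\<^sub>n - \<lambda>)\<^sup>-\<^sup>1\<close> that the maximum principle gives inside a small circle. Otherwise it has a
  neighbourhood in \<open>B\<close> whose frontier avoids \<open>\<sigma>\<^sub>s\<^sub>f(T)\<close>, and the maximum principle for the resolvents of \<open>T\<^sub>n\<close>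
  modulo finite-rank operators shows that \<open>T - \<lambda>\<close> is semi-Fredholm inside, a contradiction.
\<close>

subsection \<open>The Hahn--Banach theorem\<close>

definition sublinear :: "('v::real_vector \<Rightarrow> real) \<Rightarrow> bool" where
  "sublinear q \<longleftrightarrow> (\<forall>x y. q (x + y) \<le> q x + q y) \<and> (\<forall>t x. 0 \<le> t \<longrightarrow> q (t *\<^sub>R x) = t * q x)"

lemma sublinear_add: "sublinear q \<Longrightarrow> q (x + y) \<le> q x + q y"
  and sublinear_scale: "sublinear q \<Longrightarrow> 0 \<le> t \<Longrightarrow> q (t *\<^sub>R x) = t * q x"
  by (auto simp: sublinear_def)

lemma sublinear_zero: "sublinear q \<Longrightarrow> q 0 = 0"
  using sublinear_scale[of q 0 0] by simp

lemma sublinear_minus: "sublinear q \<Longrightarrow> - q (- x) \<le> q x"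
  using sublinear_add[of q x "- x"] sublinear_zero[of q] by simp

text \<open>One inequality for scaling suffices: applied to \<open>inverse t\<close> and the scaled
  point, it gives the reverse one. This suits functionals defined by infima.\<close>

lemma sublinearI:
  assumes "\<And>x y. q (x + y) \<le> q x + q y"
    and "\<And>t x. 0 < t \<Longrightarrow> q (t *\<^sub>R x) \<le> t * q x" and "q 0 = 0"
  shows "sublinear q"
  unfolding sublinear_def
proof (intro conjI allI impI)
  fix t :: real and x assume "0 \<le> t"
  show "q (t *\<^sub>R x) = t * q x"
  proof (cases "t = 0")
    case False
    with \<open>0 \<le> t\<close> have t: "0 < t" by simp
    have "q x \<le> inverse t * q (t *\<^sub>R x)"
      using assms(2)[of "inverse t" "t *\<^sub>R x"] t by simp
    then have "t * q x \<le> q (t *\<^sub>R x)"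
      using t by (simp add: field_simps)
    with assms(2)[OF t, of x] show ?thesis by simp
  qed (simp add: assms(3))
qed (rule assms(1))

text \<open>Pushing a sublinear functional down along the ray through \<open>a\<close>: the result
  \<open>q'\<close> satisfies \<open>q' (- a) \<le> - q a\<close>, so a minimal sublinear functional is additive.\<close>

lemma sublinear_lower:
  assumes q: "sublinear q"
  obtains q' where "sublinear q'" "\<And>x. q' x \<le> q x" "\<And>x t. 0 \<le> t \<Longrightarrow> q' x \<le> q (x + t *\<^sub>R a) - t * q a"
proof
  let ?S = "\<lambda>x. (\<lambda>t. q (x + t *\<^sub>R a) - t * q a) ` {0..}"
  define q' where "q' = (\<lambda>x. Inf (?S x))"
  \<comment> \<open>A lower bound independent of \<open>t\<close>, so that every infimum is
    finite.\<close>
  have low: "- q (- x) \<le> q (x + t *\<^sub>R a) - t * q a" if "0 \<le> t" for x t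
    using sublinear_add[OF q, of "x + t *\<^sub>R a" "- x"] sublinear_scale[OF q that, of a] by simp
  have bdd: "bdd_below (?S x)" for x
    by (rule bdd_belowI[where m = "- q (- x)"]) (use low in auto)
  show le: "q' x \<le> q (x + t *\<^sub>R a) - t * q a" if "0 \<le> t" for x t
    unfolding q'_def by (rule cInf_lower[OF _ bdd]) (use that in auto)
  show "q' x \<le> q x" for x
    using le[of 0 x] by simp
  have greatest: "z \<le> q' x" if "\<And>t. 0 \<le> t \<Longrightarrow> z \<le> q (x + t *\<^sub>R a) - t * q a" for x z
    unfolding q'_def by (rule cInf_greatest) (use that in auto)
  show "sublinear q'"
  proof (rule sublinearI)
    fix x y
    have "q' (x + y) - (q (y + s *\<^sub>R a) - s * q a) \<le> q' x" if "0 \<le> s" for s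
    proof (rule greatest)
      fix t :: real assume "0 \<le> t"
      have "q' (x + y) \<le> q ((x + t *\<^sub>R a) + (y + s *\<^sub>R a)) - (t + s) * q a"
        using le[of "t + s" "x + y"] \<open>0 \<le> t\<close> that by (simp add: algebra_simps)
      also have "\<dots> \<le> q (x + t *\<^sub>R a) + q (y + s *\<^sub>R a) - (t + s) * q a"
        using sublinear_add[OF q] by (simp add: diff_right_mono)
      finally show "q' (x + y) - (q (y + s *\<^sub>R a) - s * q a) \<le> q (x + t *\<^sub>R a) - t * q a"
        by (simp add: algebra_simps)
    qed
    then have "q' (x + y) - q' x \<le> q' y"
      by (intro greatest) (simp add: algebra_simps)
    then show "q' (x + y) \<le> q' x + q' y" by simp
  next
    fix t :: real and x assume t: "0 < t"
    have "inverse t * q' (t *\<^sub>R x) \<le> q' x"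
    proof (rule greatest)
      fix s :: real assume s: "0 \<le> s"
      have "q' (t *\<^sub>R x) \<le> q (t *\<^sub>R (x + s *\<^sub>R a)) - t * s * q a"
        using le[of "t * s" "t *\<^sub>R x"] s t by (simp add: algebra_simps)
      also have "\<dots> = t * (q (x + s *\<^sub>R a) - s * q a)"
        using sublinear_scale[OF q, of t "x + s *\<^sub>R a"] t by (simp add: right_diff_distrib)
      finally show "inverse t * q' (t *\<^sub>R x) \<le> q (x + s *\<^sub>R a) - s * q a"
        using t by (simp add: field_simps)
    qed
    then show "q' (t *\<^sub>R x) \<le> t * q' x" using t by (simp add: field_simps)
  next
    have "0 \<le> q' 0"
      by (rule greatest) (simp add: sublinear_scale[OF q])
    moreover have "q' 0 \<le> 0" using le[of 0 0] by (simp add: sublinear_zero[OF q])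
    ultimately show "q' 0 = 0" by simp
  qed
qed

text \<open>Zorn's lemma yields a minimal sublinear functional below \<open>p'\<close>, and
  minimality against \<open>sublinear_lower\<close> makes it additive. Lowering \<open>p\<close>
  along \<open>x0\<close> beforehand gives \<open>p' (- x0) \<le> - p x0\<close>, which linearity
  turns into the missing inequality at \<open>x0\<close>.\<close>

lemma Hahn_Banach_sublinear:
  fixes p :: "'v::real_vector \<Rightarrow> real"
  assumes p: "sublinear p"
  obtains f where "linear f" "\<And>x. f x \<le> p x" "f x0 = p x0"
proof -
  obtain p' where p': "sublinear p'" and p'p: "\<And>x. p' x \<le> p x"
    and p'x0: "\<And>x t. 0 \<le> t \<Longrightarrow> p' x \<le> p (x + t *\<^sub>R x0) - t * p x0"
    using sublinear_lower[OF p] by blast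
  define A where "A = {q. sublinear q \<and> (\<forall>x. q x \<le> p' x)}"
  have "\<exists>m\<in>A. \<forall>q\<in>A. (\<forall>x. q x \<le> m x) \<longrightarrow> q = m"
  \<comment> \<open>The order is reversed, so a maximal element is a pointwise minimal functional;
    chains are bounded by their pointwise infimum.\<close>
  proof (rule predicate_Zorn)
    show "partial_order_on A (relation_of (\<lambda>m q. \<forall>x. q x \<le> m x) A)"
      by (rule partial_order_on_relation_ofI) (auto intro: order_trans simp: fun_eq_iff order_antisym)
  next
    fix C assume C: "C \<in> Chains (relation_of (\<lambda>m q. \<forall>x. q x \<le> m x) A)"
    show "\<exists>u\<in>A. \<forall>a\<in>C. \<forall>x. u x \<le> a x"
    proof (cases "C = {}")
      case True
      have "p' \<in> A" using p' by (simp add: A_def)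
      then show ?thesis using True by blast
    next
      case False
      have CA: "C \<subseteq> A" using C by (auto simp: Chains_def relation_of_def)
      have tot: "(\<forall>x. q x \<le> r x) \<or> (\<forall>x. r x \<le> q x)" if "q \<in> C" "r \<in> C" for q r
        using C that by (auto simp: Chains_def relation_of_def)
      define u where "u = (\<lambda>x. INF q\<in>C. q x)"
      have sub: "sublinear q" if "q \<in> C" for q using that CA by (auto simp: A_def)
      have bdd: "bdd_below ((\<lambda>q. q x) ` C)" for x
      proof (rule bdd_belowI2[where m = "- p' (- x)"])
        fix q assume "q \<in> C"
        then have "q (- x) \<le> p' (- x)" using CA by (auto simp: A_def)
        then show "- p' (- x) \<le> q x" using sublinear_minus[OF sub[OF \<open>q \<in> C\<close>], of x] by simp
      qed
      have le: "u x \<le> q x" if "q \<in> C" for q x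
        unfolding u_def by (rule cINF_lower[OF bdd that])
      have greatest: "z \<le> u x" if "\<And>q. q \<in> C \<Longrightarrow> z \<le> q x" for x z
        unfolding u_def by (rule cINF_greatest[OF False that])
      have "sublinear u"
      proof (rule sublinearI)
        fix x y
        have "u (x + y) - r y \<le> u x" if r: "r \<in> C" for r
        proof (rule greatest)
          fix q assume q: "q \<in> C"
          \<comment> \<open>The smaller of \<open>q\<close> and \<open>r\<close> is evaluated at
            \<open>x + y\<close>, where its own subadditivity applies.\<close>
          from tot[OF q r] show "u (x + y) - r y \<le> q x"
          proof
            assume "\<forall>x. q x \<le> r x"
            then have "q y \<le> r y" by blast
            then show ?thesis using le[OF q, of "x + y"] sublinear_add[OF sub[OF q], of x y] by simp
          next
            assume "\<forall>x. r x \<le> q x"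
            then have "r x \<le> q x" by blast
            then show ?thesis using le[OF r, of "x + y"] sublinear_add[OF sub[OF r], of x y] by simp
          qed
        qed
        then have "u (x + y) - u x \<le> u y"
          by (intro greatest) (simp add: algebra_simps)
        then show "u (x + y) \<le> u x + u y" by simp
      next
        fix t :: real and x assume t: "0 < t"
        have "inverse t * u (t *\<^sub>R x) \<le> u x"
        proof (rule greatest)
          fix q assume q: "q \<in> C"
          show "inverse t * u (t *\<^sub>R x) \<le> q x"
            using le[OF q, of "t *\<^sub>R x"] sublinear_scale[OF sub[OF q], of t x] t by (simp add: field_simps)
        qed
        then show "u (t *\<^sub>R x) \<le> t * u x" using t by (simp add: field_simps)
      next
        obtain q where q: "q \<in> C" using False by blast
        have "0 \<le> u 0" by (rule greatest) (simp add: sublinear_zero[OF sub])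
        moreover have "u 0 \<le> 0" using le[OF q, of 0] by (simp add: sublinear_zero[OF sub[OF q]])
        ultimately show "u 0 = 0" by simp
      qed
      moreover obtain q where "q \<in> C" using False by blast
      then have "u x \<le> p' x" for x
        using le[OF \<open>q \<in> C\<close>, of x] \<open>q \<in> C\<close> CA unfolding A_def by (blast intro: order_trans)
      ultimately have "u \<in> A" by (simp add: A_def)
      then show ?thesis using le by blast
    qed
  qed
  then obtain m where mA: "m \<in> A" and min: "\<And>q. q \<in> A \<Longrightarrow> (\<And>x. q x \<le> m x) \<Longrightarrow> q = m"
    by blast
  have m: "sublinear m" and mp': "\<And>x. m x \<le> p' x" using mA by (auto simp: A_def)
  have add: "m (x + a) = m x + m a" for x a
  proof (rule order_antisym)
    obtain q' where q': "sublinear q'" "\<And>x. q' x \<le> m x" "\<And>x t. 0 \<le> t \<Longrightarrow> q' x \<le> m (x + t *\<^sub>R a) - t * m a"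
      using sublinear_lower[OF m] by blast
    have "q' \<in> A" using q'(1,2) mp' by (auto simp: A_def intro: order_trans)
    then have "q' = m" using min q'(2) by blast
    then show "m x + m a \<le> m (x + a)" using q'(3)[of 1 x] by simp
  qed (rule sublinear_add[OF m])
  have neg: "m (- x) = - m x" for x
    using add[of x "- x"] sublinear_zero[OF m] by simp
  have "linear m"
  proof (rule linearI)
    fix r :: real and x
    show "m (r *\<^sub>R x) = r *\<^sub>R m x"
    proof (cases "0 \<le> r")
      case False
      then have "m ((- r) *\<^sub>R x) = - r * m x" by (intro sublinear_scale[OF m]) simp
      then show ?thesis by (simp add: neg)
    qed (simp add: sublinear_scale[OF m])
  qed (rule add)
  moreover have "m x \<le> p x" for x using mp' p'p by (rule order_trans)
  moreover have "m x0 = p x0"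
  proof (rule order_antisym)
    have "m (- x0) \<le> p 0 - p x0" using mp'[of "- x0"] p'x0[of 1 "- x0"] by simp
    then show "p x0 \<le> m x0" by (simp add: neg sublinear_zero[OF p])
  qed (rule \<open>m x0 \<le> p x0\<close>)
  ultimately show thesis by (rule that)
qed

lemma sublinear_infdist:
  fixes M :: "'v::real_normed_vector set"
  assumes M: "subspace M"
  shows "sublinear (\<lambda>x. infdist x M)"
proof (rule sublinearI)
  have ne: "M \<noteq> {}" using subspace_0[OF M] by blast
  fix x y
  have "infdist (x + y) M - dist x a \<le> infdist y M" if "a \<in> M" for a
    unfolding infdist_def[of y] using ne
  proof (simp, intro cINF_greatest)
    fix b assume "b \<in> M"
    then have "infdist (x + y) M \<le> dist (x + y) (a + b)"
      using that by (intro infdist_le subspace_add[OF M])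
    also have "\<dots> \<le> dist x a + dist y b" by (rule dist_triangle_add)
    finally show "infdist (x + y) M - dist x a \<le> dist y b" by simp
  qed
  then have "infdist (x + y) M - infdist y M \<le> infdist x M"
    unfolding infdist_def[of x] using ne
    by (simp, intro cINF_greatest) (auto simp: algebra_simps)
  then show "infdist (x + y) M \<le> infdist x M + infdist y M" by simp
next
  have ne: "M \<noteq> {}" using subspace_0[OF M] by blast
  fix t :: real and x assume t: "0 < t"
  have "inverse t * infdist (t *\<^sub>R x) M \<le> infdist x M"
    unfolding infdist_def[of x] using ne
  proof (simp, intro cINF_greatest)
    fix a assume "a \<in> M"
    then have "infdist (t *\<^sub>R x) M \<le> dist (t *\<^sub>R x) (t *\<^sub>R a)"
      by (intro infdist_le subspace_scale[OF M])
    also have "\<dots> = t * dist x a" using t by (simp add: dist_norm flip: scaleR_diff_right)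
    finally show "inverse t * infdist (t *\<^sub>R x) M \<le> dist x a" using t by (simp add: field_simps)
  qed
  then show "infdist (t *\<^sub>R x) M \<le> t * infdist x M" using t by (simp add: field_simps)
qed (simp add: subspace_0[OF M])

lemma infdist_uminus:
  fixes M :: "'v::real_normed_vector set"
  assumes M: "subspace M"
  shows "infdist (- x) M = infdist x M"
proof -
  have "infdist (- x) M \<le> infdist x M" for x
  proof -
    have "M \<noteq> {}" using subspace_0[OF M] by blast
    then show ?thesis
      unfolding infdist_def[of x]
    proof (simp, intro cINF_greatest)
      fix a assume "a \<in> M"
      then have "infdist (- x) M \<le> dist (- x) (- a)"
        by (intro infdist_le subspace_neg[OF M])
      then show "infdist (- x) M \<le> dist x a" by (simp add: dist_minus)
    qed
  qed
  from this[of x] this[of "- x"] show ?thesis by simp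
qed

text \<open>Domination by the distance makes the functional vanish on \<open>M\<close> and have norm
  at most 1. It is applied both to subspaces of the Banach space and to spaces of operators.\<close>

lemma Hahn_Banach_infdist:
  fixes M :: "'v::real_normed_vector set"
  assumes M: "subspace M"
  obtains f where "linear f" "\<And>x. \<bar>f x\<bar> \<le> infdist x M" "f x0 = infdist x0 M"
proof -
  obtain f where f: "linear f" "\<And>x. f x \<le> infdist x M" "f x0 = infdist x0 M"
    using Hahn_Banach_sublinear[OF sublinear_infdist[OF M]] by blast
  have "\<bar>f x\<bar> \<le> infdist x M" for x
    using f(2)[of x] f(2)[of "- x"] infdist_uminus[OF M, of x] linear_neg[OF f(1), of x] by simp
  with f show thesis using that by blast
qed

lemma infdist_subspace_le_norm:
  fixes M :: "'v::real_normed_vector set"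
  assumes "subspace M"
  shows "infdist x M \<le> norm x"
  using infdist_le[OF subspace_0[OF assms], of x] by simp

subsection \<open>The open mapping theorem\<close>

text \<open>The error halves at each step, so the corrections \<open>g (r n)\<close> are dominated
  by a geometric series with sum \<open>2 * C * norm y\<close>, and completeness of the domain
  provides their sum. The subspace \<open>R\<close> keeps the errors where \<open>step\<close>
  applies. The same iteration drives the open mapping theorem and the inversion of perturbed
  operators.\<close>

lemma successive_approximation:
  fixes A :: "'v::banach \<Rightarrow>\<^sub>L 'w::real_normed_vector"
  assumes C: "0 \<le> C" and R: "subspace R"
    and step: "\<And>y. y \<in> R \<Longrightarrow> \<exists>x. norm x \<le> C * norm y \<and> norm (y - A x) \<le> norm y / 2 \<and> A x \<in> R"
    and y: "y \<in> R"
  obtains x where "A x = y" "norm x \<le> 2 * C * norm y"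
proof -
  obtain g where g: "\<And>y. y \<in> R \<Longrightarrow> norm (g y) \<le> C * norm y"
      "\<And>y. y \<in> R \<Longrightarrow> norm (y - A (g y)) \<le> norm y / 2" "\<And>y. y \<in> R \<Longrightarrow> A (g y) \<in> R"
    using step by metis
  define r where "r = rec_nat y (\<lambda>_ y. y - A (g y))"
  have r0: "r 0 = y" and rSuc: "r (Suc n) = r n - A (g (r n))" for n by (simp_all add: r_def)
  have rR: "r n \<in> R" for n
    by (induction n) (simp_all add: r0 rSuc y g(3) subspace_diff[OF R])
  have rn: "norm (r n) \<le> norm y * (1/2) ^ n" for n
  proof (induction n)
    case (Suc n)
    have "norm (r (Suc n)) \<le> norm (r n) / 2" using g(2)[OF rR[of n]] by (simp add: rSuc)
    with Suc show ?case by simp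
  qed (simp add: r0)
  have gn: "norm (g (r n)) \<le> C * norm y * (1/2) ^ n" for n
    using g(1)[OF rR[of n]] mult_left_mono[OF rn[of n] C] by (simp add: mult.assoc)
  have sums: "(\<lambda>n. C * norm y * (1/2) ^ n) sums (C * norm y * 2)"
    using sums_mult[OF geometric_sums[of "1/2 :: real"]] by simp
  have summ: "summable (\<lambda>n. norm (g (r n)))"
    by (rule summable_comparison_test'[OF sums_summable[OF sums], of 0]) (simp add: gn)
  have gsum: "(\<lambda>n. g (r n)) sums (\<Sum>n. g (r n))"
    using summable_norm_cancel[OF summ] by (rule summable_sums)
  have part: "A (\<Sum>i<n. g (r i)) = y - r n" for n
    by (induction n) (simp_all add: r0 rSuc blinfun.add_right)
  have "r \<longlonglongrightarrow> 0"
  proof (rule Lim_null_comparison)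
    show "(\<lambda>n. norm y * (1/2) ^ n) \<longlonglongrightarrow> 0"
      by (intro tendsto_mult_right_zero LIMSEQ_realpow_zero) auto
  qed (simp add: rn)
  then have "(\<lambda>n. y - r n) \<longlonglongrightarrow> y" using tendsto_diff[OF tendsto_const[of y]] by fastforce
  moreover have "(\<lambda>n. y - r n) \<longlonglongrightarrow> A (\<Sum>n. g (r n))"
    using blinfun.tendsto[OF tendsto_const[of A] gsum[unfolded sums_def]] by (simp add: part)
  ultimately have "A (\<Sum>n. g (r n)) = y" by (rule LIMSEQ_unique[symmetric])
  moreover have "norm (\<Sum>n. g (r n)) \<le> 2 * C * norm y"
  proof -
    have "norm (\<Sum>n. g (r n)) \<le> (\<Sum>n. norm (g (r n)))" by (rule summable_norm[OF summ])
    also have "\<dots> \<le> (\<Sum>n. C * norm y * (1/2) ^ n)"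
      by (rule suminf_le[OF gn summ sums_summable[OF sums]])
    also have "\<dots> = 2 * C * norm y" using sums_unique[OF sums] by simp
    finally show ?thesis .
  qed
  ultimately show thesis by (rule that)
qed

text \<open>A closed range is completely metrizable, so Baire's theorem puts a relative ball inside
  the closure of the image of some ball. Differences of approximate preimages then solve
  \<open>A x = y\<close> up to half the norm, and \<open>successive_approximation\<close> removes
  the error.\<close>

theorem open_mapping_closed_range:
  fixes A :: "'v::banach \<Rightarrow>\<^sub>L 'w::banach"
  assumes cl: "closed (range A)"
  obtains C where "0 \<le> C" "\<And>y. y \<in> range A \<Longrightarrow> \<exists>x. A x = y \<and> norm x \<le> C * norm y"
proof -
  define R where "R = range A"
  have Rsub: "subspace R"
    unfolding R_def by (intro linear_subspace_image bounded_linear.linear blinfun.bounded_linear_right subspace_UNIV)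
  define U where "U = (\<lambda>n. closure (A ` cball 0 (real n)))"
  have UR: "U n \<subseteq> R" for n
    unfolding U_def R_def by (rule closure_minimal[OF _ cl]) auto
  have "top_of_set R interior_of \<Union>(range U) \<noteq> {}"
  proof -
    have "\<Union>(range U) = R"
    proof (rule equalityI)
      show "R \<subseteq> \<Union>(range U)"
      proof
        fix y assume "y \<in> R"
        then obtain x where x: "y = A x" by (auto simp: R_def)
        obtain n where "norm x \<le> real n" using real_arch_simple by blast
        then have "y \<in> U n" unfolding U_def x by (intro subsetD[OF closure_subset]) simp
        then show "y \<in> \<Union>(range U)" by blast
      qed
    qed (use UR in blast)
    then have "top_of_set R interior_of \<Union>(range U) = R"
      using interior_of_topspace[of "top_of_set R"] by simp
    then show ?thesis using subspace_0[OF Rsub] by blast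
  qed
  moreover have "completely_metrizable_space (top_of_set R)"
    using cl completely_metrizable_space_closedin[OF completely_metrizable_space_euclidean]
    by (simp add: R_def)
  moreover have "closedin (top_of_set R) (U n)" for n
    by (rule closed_subset[OF UR]) (simp add: U_def)
  ultimately obtain n where "top_of_set R interior_of U n \<noteq> {}"
    using Baire_category_alt[of "top_of_set R" "range U"] by auto
  then obtain W y0 where "openin (top_of_set R) W" "y0 \<in> W" "W \<subseteq> U n"
    by (auto simp: interior_of_def)
  then obtain e where e: "0 < e" and "ball y0 e \<inter> R \<subseteq> W" and y0: "y0 \<in> R"
    unfolding openin_contains_ball by blast
  with \<open>W \<subseteq> U n\<close> have sub: "ball y0 e \<inter> R \<subseteq> U n" by blast
  define C where "C = 4 * (real n + 1) / e"
  have C: "0 \<le> C" using e by (simp add: C_def)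
  have step: "\<exists>x. norm x \<le> C * norm y \<and> norm (y - A x) \<le> norm y / 2 \<and> A x \<in> R" if y: "y \<in> R" for y
  proof (cases "y = 0")
    case True
    then show ?thesis by (intro exI[of _ 0]) (simp add: subspace_0[OF Rsub])
  next
    case False
    \<comment> \<open>With this scale \<open>s *\<^sub>R y\<close> has norm \<open>e / 2\<close>, so
      adding it to \<open>y0\<close> stays in the ball. Two errors of \<open>e / 8\<close> add up to
      half of that norm, and scaling back by \<open>inverse s\<close> produces the constant
      \<open>C\<close>.\<close>
    define s where "s = e / (2 * norm y)"
    have s: "0 < s" using False e by (simp add: s_def)
    have approx: "\<exists>x. norm x \<le> real n \<and> dist (A x) v < e / 8" if "v \<in> U n" for v
    proof -
      have "\<exists>w\<in>A ` cball 0 (real n). dist w v < e / 8"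
        using that e unfolding U_def closure_approachable by (meson divide_pos_pos zero_less_numeral)
      then show ?thesis by auto
    qed
    have "norm (s *\<^sub>R y) < e" using s False e by (simp add: s_def)
    then have "y0 + s *\<^sub>R y \<in> ball y0 e \<inter> R"
      using y y0 Rsub by (auto simp: dist_norm subspace_add subspace_scale)
    then obtain x1 where x1: "norm x1 \<le> real n" "dist (A x1) (y0 + s *\<^sub>R y) < e / 8"
      using approx sub by blast
    have "y0 \<in> ball y0 e \<inter> R" using e y0 by simp
    then obtain x2 where x2: "norm x2 \<le> real n" "dist (A x2) y0 < e / 8"
      using approx sub by blast
    define x where "x = inverse s *\<^sub>R (x1 - x2)"
    have "s *\<^sub>R y - A (x1 - x2) = ((y0 + s *\<^sub>R y) - A x1) - (y0 - A x2)"
      by (simp add: blinfun.diff_right)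
    then have "norm (s *\<^sub>R y - A (x1 - x2)) \<le> norm ((y0 + s *\<^sub>R y) - A x1) + norm (y0 - A x2)"
      by (simp only: norm_triangle_ineq4)
    also have "\<dots> \<le> e / 4" using x1(2) x2(2) by (simp add: dist_norm norm_minus_commute)
    finally have d: "norm (s *\<^sub>R y - A (x1 - x2)) \<le> e / 4" .
    have "y - A x = inverse s *\<^sub>R (s *\<^sub>R y - A (x1 - x2))"
      using s by (simp add: x_def blinfun.scaleR_right blinfun.diff_right scaleR_diff_right)
    then have "norm (y - A x) \<le> inverse s * (e / 4)" using d s by (simp add: mult_left_mono)
    also have "\<dots> = norm y / 2" using e False by (simp add: s_def field_simps)
    finally have 1: "norm (y - A x) \<le> norm y / 2" .
    have "norm (x1 - x2) \<le> 2 * (real n + 1)"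
      using norm_triangle_ineq4[of x1 x2] x1(1) x2(1) by simp
    then have "norm x \<le> inverse s * (2 * (real n + 1))" using s by (simp add: x_def mult_left_mono)
    also have "\<dots> = C * norm y" using e False by (simp add: s_def C_def field_simps)
    finally show ?thesis using 1 by (auto simp: R_def)
  qed
  show thesis
  proof (rule that[of "2 * C"])
    fix y assume "y \<in> range A"
    then have "y \<in> R" by (simp add: R_def)
    from successive_approximation[OF C Rsub step this] obtain x where "A x = y" "norm x \<le> 2 * C * norm y" .
    then show "\<exists>x. A x = y \<and> norm x \<le> 2 * C * norm y" by blast
  qed (use C in simp)
qed

subsection \<open>Complex-linear bounded operators\<close>

interpretation C: vector_space "scaleC :: complex \<Rightarrow> 'a::cbanach \<Rightarrow> 'a"
  by (rule vector_space_scaleC)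

lemma bounded_linear_scaleC: "bounded_linear (scaleC c :: 'a::cbanach \<Rightarrow> 'a)"
proof (rule bounded_linear_intro)
  show "scaleC c (r *\<^sub>R x) = r *\<^sub>R scaleC c x" for r and x :: 'a
    by (simp add: scaleR_scaleC scaleC_scaleC mult.commute)
  show "norm (scaleC c x) \<le> norm x * cmod c" for x :: 'a
    by (simp add: norm_scaleC mult.commute)
qed (rule scaleC_add_right)

definition scal_op :: "complex \<Rightarrow> 'a::cbanach \<Rightarrow>\<^sub>L 'a" where
  "scal_op c = Blinfun (scaleC c)"

lemma scal_op_apply [simp]: "scal_op c x = scaleC c x"
  by (simp add: scal_op_def bounded_linear_Blinfun_apply[OF bounded_linear_scaleC])

text \<open>For \<open>c \<noteq> 0\<close> equality fails on the zero space, where every operator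
  has norm 0.\<close>

lemma norm_scal_op_le: "norm (scal_op c) \<le> cmod c"
  by (rule norm_blinfun_bound) (simp_all add: norm_scaleC)

lemma scal_op_diff: "scal_op (a - b) = scal_op a - scal_op b"
  by (rule blinfun_eqI) (simp add: blinfun.diff_left C.scale_left_diff_distrib)

lemma shift_op_eq: "shift_op T l = blinfun_apply (T - scal_op l)"
  by (simp add: fun_eq_iff shift_op_def blinfun.diff_left)

lemma csubspace_imp_subspace: "C.subspace M \<Longrightarrow> subspace M"
  by (simp add: subspace_def C.subspace_def scaleR_scaleC)

lemma clinear_op_scaleC: "clinear_op A \<Longrightarrow> A (scaleC c x) = scaleC c (A x)"
  by (simp add: clinear_op_def)

lemma clinear_op_module_hom: "clinear_op A \<Longrightarrow> module_hom scaleC scaleC (blinfun_apply A)"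
  by (simp add: module_hom_iff C.module_axioms blinfun.add_right clinear_op_def)

lemma clinear_op_zero: "clinear_op 0"
  and clinear_op_id: "clinear_op id_blinfun"
  and clinear_op_scal: "clinear_op (scal_op c)"
  and clinear_op_add: "clinear_op A \<Longrightarrow> clinear_op B \<Longrightarrow> clinear_op (A + B)"
  and clinear_op_diff: "clinear_op A \<Longrightarrow> clinear_op B \<Longrightarrow> clinear_op (A - B)"
  and clinear_op_minus: "clinear_op A \<Longrightarrow> clinear_op (- A)"
  and clinear_op_scaleR: "clinear_op A \<Longrightarrow> clinear_op (r *\<^sub>R A)"
  and clinear_op_compose: "clinear_op A \<Longrightarrow> clinear_op B \<Longrightarrow> clinear_op (A o\<^sub>L B)"
  by (simp_all add: clinear_op_def blinfun.bilinear_simps scaleC_add_right C.scale_right_diff_distrib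
      scaleC_scaleC scaleR_scaleC mult.commute)

lemmas clinear_op_intros = clinear_op_zero clinear_op_id clinear_op_scal clinear_op_add clinear_op_diff
  clinear_op_minus clinear_op_scaleR clinear_op_compose

lemma csubspace_range: "clinear_op A \<Longrightarrow> C.subspace (range A)"
  using module_hom.subspace_image[OF clinear_op_module_hom C.subspace_UNIV] .

lemma csubspace_kernel: "clinear_op A \<Longrightarrow> C.subspace (kernel A)"
  using module_hom.subspace_kernel[OF clinear_op_module_hom] by (simp add: kernel_def)

text \<open>The real functional \<open>\<phi>\<close> is complexified to \<open>h\<close>. As
  \<open>M\<close> is closed under multiplication by \<open>\<i>\<close>, \<open>h\<close> still
  vanishes on \<open>M\<close>; its real part at \<open>g\<close> is the positive distance to
  \<open>M\<close>, so \<open>h\<close> can be normalised.\<close>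

lemma bounded_functional_vanishing_on:
  fixes M :: "'a::cbanach set"
  assumes cl: "closed M" and M: "C.subspace M" and g: "g \<notin> M"
  obtains f :: "'a \<Rightarrow> complex" where "bounded_linear f" "\<And>c x. f (scaleC c x) = c * f x"
    "\<And>x. x \<in> M \<Longrightarrow> f x = 0" "f g = 1"
proof -
  have sM: "subspace M" using M by (rule csubspace_imp_subspace)
  obtain \<phi> where \<phi>: "linear \<phi>" "\<And>x. \<bar>\<phi> x\<bar> \<le> infdist x M" "\<phi> g = infdist g M"
    using Hahn_Banach_infdist[OF sM] by blast
  have \<phi>le: "\<bar>\<phi> x\<bar> \<le> norm x" for x
    using \<phi>(2)[of x] infdist_subspace_le_norm[OF sM, of x] by simp
  define h where "h = (\<lambda>x. Complex (\<phi> x) (- \<phi> (scaleC \<i> x)))"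
  have hadd: "h (x + y) = h x + h y" for x y
    by (simp add: h_def scaleC_add_right linear_add[OF \<phi>(1)] complex_eq_iff)
  have hscaleR: "h (r *\<^sub>R x) = r *\<^sub>R h x" for r x
  proof -
    have "scaleC \<i> (r *\<^sub>R x) = r *\<^sub>R scaleC \<i> x" by (simp add: scaleR_scaleC scaleC_scaleC mult.commute)
    then show ?thesis by (simp add: h_def linear_cmul[OF \<phi>(1)] complex_eq_iff)
  qed
  have hi: "h (scaleC \<i> x) = \<i> * h x" for x
  proof -
    have "scaleC \<i> (scaleC \<i> x) = - x" by (simp add: scaleC_scaleC C.scale_minus_left scaleC_one)
    then show ?thesis by (simp add: h_def linear_neg[OF \<phi>(1)] complex_eq_iff)
  qed
  have hscaleC: "h (scaleC c x) = c * h x" for c x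
  proof -
    have "scaleC c x = Re c *\<^sub>R x + Im c *\<^sub>R scaleC \<i> x"
    proof -
      have "scaleC c x = scaleC (of_real (Re c) + of_real (Im c) * \<i>) x"
        by (simp add: complex_eq_iff)
      then show ?thesis by (simp only: scaleC_add_left scaleR_scaleC scaleC_scaleC)
    qed
    then have "h (scaleC c x) = Re c *\<^sub>R h x + Im c *\<^sub>R (\<i> * h x)" by (simp add: hadd hscaleR hi)
    also have "\<dots> = c * h x" by (simp add: complex_eq_iff)
    finally show ?thesis .
  qed
  have hM: "h x = 0" if "x \<in> M" for x
  proof -
    have "scaleC \<i> x \<in> M" using M that by (rule C.subspace_scale)
    then show ?thesis
      using \<phi>(2)[of x] \<phi>(2)[of "scaleC \<i> x"] that by (simp add: h_def complex_eq_iff)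
  qed
  have hbl: "bounded_linear h"
  proof (rule bounded_linear_intro[OF hadd hscaleR])
    fix x
    have "norm (h x) \<le> \<bar>\<phi> x\<bar> + \<bar>\<phi> (scaleC \<i> x)\<bar>" using cmod_le[of "h x"] by (simp add: h_def)
    also have "\<dots> \<le> norm x * 2" using \<phi>le[of x] \<phi>le[of "scaleC \<i> x"] by (simp add: norm_scaleC)
    finally show "norm (h x) \<le> norm x * 2" .
  qed
  have "infdist g M > 0"
    using infdist_pos_not_in_closed[OF cl _ g] C.subspace_0[OF M] by blast
  then have hg: "h g \<noteq> 0" by (simp add: h_def \<phi>(3) complex_eq_iff)
  show thesis
  proof (rule that[of "\<lambda>x. h x / h g"])
    show "bounded_linear (\<lambda>x. h x / h g)" by (rule bounded_linear_compose[OF bounded_linear_divide hbl])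
  qed (use hg in \<open>simp_all add: hscaleC hM\<close>)
qed

definition rank_one :: "('a \<Rightarrow> complex) \<Rightarrow> 'a \<Rightarrow> 'a::cbanach \<Rightarrow>\<^sub>L 'a" where
  "rank_one f g = Blinfun (\<lambda>x. scaleC (f x) g)"

lemma rank_one_apply:
  assumes "bounded_linear f"
  shows "rank_one f g x = scaleC (f x) g"
proof -
  interpret f: bounded_linear f by fact
  have "bounded_linear (\<lambda>x. scaleC (f x) g)"
  proof (rule bounded_linear_intro)
    show "scaleC (f (r *\<^sub>R x)) g = r *\<^sub>R scaleC (f x) g" for r x
      by (simp add: f.scaleR scaleR_scaleC[of r "scaleC (f x) g"] scaleR_conv_of_real)
    show "norm (scaleC (f x) g) \<le> norm x * (onorm f * norm g)" for x
      using mult_right_mono[OF onorm[OF assms, of x], of "norm g"] by (simp add: norm_scaleC ac_simps)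
  qed (simp add: f.add scaleC_add_left)
  then show ?thesis by (simp add: rank_one_def bounded_linear_Blinfun_apply)
qed

text \<open>With \<open>f\<close> vanishing on \<open>M\<close> and \<open>f g = 1\<close>, the span
  is the preimage of \<open>M\<close> under the continuous operator
  \<open>id_blinfun - rank_one f g\<close>.\<close>

lemma closed_span_insert:
  fixes M :: "'a::cbanach set"
  assumes cl: "closed M" and M: "C.subspace M"
  shows "closed (cspan (insert g M))"
proof (cases "g \<in> M")
  case True
  then have "cspan (insert g M) = M" using M by (simp add: insert_absorb)
  then show ?thesis using cl by simp
next
  case False
  obtain f :: "'a \<Rightarrow> complex" where f: "bounded_linear f" "\<And>c x. f (scaleC c x) = c * f x"
    "\<And>x. x \<in> M \<Longrightarrow> f x = 0" "f g = 1"
    using bounded_functional_vanishing_on[OF cl M False] by blast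
  have sp: "cspan M = M" using M by simp
  have "cspan (insert g M) = (id_blinfun - rank_one f g) -` M"
  proof (intro set_eqI iffI)
    fix x assume "x \<in> cspan (insert g M)"
    then obtain k where k: "x - scaleC k g \<in> M" by (auto simp: C.span_insert sp)
    then have "f (x - scaleC k g) = 0" by (rule f(3))
    then have "f x = k" by (simp add: linear_diff[OF bounded_linear.linear[OF f(1)]] f(2,4))
    with k show "x \<in> (id_blinfun - rank_one f g) -` M"
      by (simp add: blinfun.diff_left rank_one_apply[OF f(1)])
  next
    fix x assume "x \<in> (id_blinfun - rank_one f g) -` M"
    then show "x \<in> cspan (insert g M)"
      by (auto simp: blinfun.diff_left rank_one_apply[OF f(1)] C.span_insert sp)
  qed
  moreover have "closed ((id_blinfun - rank_one f g) -` M)"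
    by (intro continuous_closed_vimage[OF cl] linear_continuous_at blinfun.bounded_linear_right)
  ultimately show ?thesis by simp
qed

lemma closed_span_Un_finite:
  fixes M :: "'a::cbanach set"
  assumes "finite F" "closed M" "C.subspace M"
  shows "closed (cspan (M \<union> F))"
  using assms
proof (induction F arbitrary: M rule: finite_induct)
  case (insert g F)
  have "cspan (M \<union> insert g F) = cspan (cspan (insert g M) \<union> F)"
    by (simp add: C.span_Un C.span_span flip: Un_insert_left)
  then show ?case using insert.IH[OF closed_span_insert[OF insert.prems] C.subspace_span] by simp
next
  case empty
  then have "cspan M = M" by simp
  with empty(1) show ?case by (simp only: Un_empty_right)
qed

subsection \<open>Invertible operators\<close>

text \<open>The inverse is an explicit argument, so that bounds on its norm can be stated.\<close>

definition inverse_ops :: "('a::cbanach \<Rightarrow>\<^sub>L 'a) \<Rightarrow> ('a \<Rightarrow>\<^sub>L 'a) \<Rightarrow> bool" where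
  "inverse_ops A B \<longleftrightarrow> clinear_op A \<and> clinear_op B \<and> A o\<^sub>L B = id_blinfun \<and> B o\<^sub>L A = id_blinfun"

lemma inverse_ops_apply:
  assumes "inverse_ops A B"
  shows "A (B x) = x" "B (A x) = x"
  using assms unfolding inverse_ops_def by (metis blinfun_apply_blinfun_compose blinfun_apply_id_blinfun id_apply)+

lemma inverse_opsI:
  assumes "clinear_op A" "clinear_op B" "\<And>x. A (B x) = x" "\<And>x. B (A x) = x"
  shows "inverse_ops A B"
  using assms by (simp add: inverse_ops_def blinfun_eqI)

lemma inverse_ops_clinear: "inverse_ops A B \<Longrightarrow> clinear_op A" "inverse_ops A B \<Longrightarrow> clinear_op B"
  by (simp_all add: inverse_ops_def)

lemma inverse_ops_unique: "inverse_ops A B \<Longrightarrow> inverse_ops A B' \<Longrightarrow> B = B'"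
  by (rule blinfun_eqI) (metis inverse_ops_apply)

lemma inverse_ops_compose:
  assumes "inverse_ops A A'" "inverse_ops B B'"
  shows "inverse_ops (A o\<^sub>L B) (B' o\<^sub>L A')"
  by (rule inverse_opsI)
    (use assms in \<open>auto intro: clinear_op_compose inverse_ops_clinear simp: inverse_ops_apply\<close>)

lemma invertible_op_iff:
  assumes "clinear_op A"
  shows "invertible_op (blinfun_apply A) \<longleftrightarrow> (\<exists>B. inverse_ops A B)"
proof
  assume "invertible_op (blinfun_apply A)"
  then obtain R where R: "bounded_linear R" "\<And>c x. R (scaleC c x) = scaleC c (R x)"
    "R \<circ> A = id" "A \<circ> R = id"
    unfolding invertible_op_def by blast
  have app: "blinfun_apply (Blinfun R) = R" by (rule bounded_linear_Blinfun_apply[OF R(1)])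
  have "inverse_ops A (Blinfun R)"
    using R(2-4) assms by (intro inverse_opsI) (auto simp: app clinear_op_def fun_eq_iff)
  then show "\<exists>B. inverse_ops A B" by blast
next
  assume "\<exists>B. inverse_ops A B"
  then obtain B where B: "inverse_ops A B" by blast
  show "invertible_op (blinfun_apply A)"
    unfolding invertible_op_def
    by (rule exI[of _ "blinfun_apply B"])
      (auto simp: inverse_ops_apply[OF B] fun_eq_iff clinear_op_scaleC[OF inverse_ops_clinear(2)[OF B]]
        blinfun.bounded_linear_right)
qed

lemma notin_spectrum_iff:
  assumes "clinear_op T"
  shows "l \<notin> spectrum_op T \<longleftrightarrow> (\<exists>B. inverse_ops (T - scal_op l) B)"
  by (simp add: spectrum_op_def shift_op_eq invertible_op_iff clinear_op_diff clinear_op_scal assms)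

lemma inverse_ops_of_bijective:
  assumes A: "clinear_op A" and C: "0 \<le> C"
    and surj: "\<And>y. \<exists>x. A x = y \<and> norm x \<le> C * norm y"
    and inj: "\<And>x. A x = 0 \<Longrightarrow> x = 0"
  obtains B where "inverse_ops A B" "norm B \<le> C"
proof -
  obtain g where g: "\<And>y. A (g y) = y" "\<And>y. norm (g y) \<le> C * norm y" using surj by metis
  have inj': "x = y" if "A x = A y" for x y
    using inj[of "x - y"] that by (simp add: blinfun.diff_right)
  have "bounded_linear g"
  proof (rule bounded_linear_intro)
    show "g (x + y) = g x + g y" for x y by (rule inj') (simp add: g blinfun.add_right)
    show "g (r *\<^sub>R x) = r *\<^sub>R g x" for r x by (rule inj') (simp add: g blinfun.scaleR_right)
    show "norm (g x) \<le> norm x * C" for x using g(2)[of x] by (simp add: mult.commute)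
  qed
  then have app: "blinfun_apply (Blinfun g) = g" by (rule bounded_linear_Blinfun_apply)
  have "inverse_ops A (Blinfun g)"
  proof (rule inverse_opsI[OF A])
    have "g (scaleC c x) = scaleC c (g x)" for c x by (rule inj') (simp add: g clinear_op_scaleC[OF A])
    then show "clinear_op (Blinfun g)" by (simp add: clinear_op_def app)
    show "Blinfun g (A x) = x" for x by (rule inj') (simp add: app g)
  qed (simp add: app g)
  moreover have "norm (Blinfun g) \<le> C" by (rule norm_blinfun_bound[OF C]) (simp add: app g)
  ultimately show thesis by (rule that)
qed

text \<open>A Neumann series in disguise: \<open>V z\<close> solves \<open>(W + D) x = z\<close> up
  to the error \<open>D (V z)\<close>, which has at most half the norm of \<open>z\<close>, and
  \<open>successive_approximation\<close> sums the corrections. The threshold \<open>1/2\<close>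
  produces the factor 2.\<close>

lemma inverse_ops_perturb:
  assumes WV: "inverse_ops W V" and D: "clinear_op D" and small: "norm D * norm V \<le> 1/2"
  obtains V' where "inverse_ops (W + D) V'" "norm V' \<le> 2 * norm V"
proof (rule inverse_ops_of_bijective[of "W + D" "2 * norm V"])
  show "clinear_op (W + D)" by (rule clinear_op_add[OF inverse_ops_clinear(1)[OF WV] D])
  show "0 \<le> 2 * norm V" by simp
  fix y
  have DV: "norm (D (V z)) \<le> norm z / 2" for z
  proof -
    have "norm (D (V z)) \<le> norm D * (norm V * norm z)"
      by (rule order_trans[OF norm_blinfun mult_left_mono[OF norm_blinfun norm_ge_zero]])
    also have "\<dots> \<le> 1/2 * norm z" using mult_right_mono[OF small, of "norm z"] by (simp add: mult.assoc)
    finally show ?thesis by simp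
  qed
  have "\<exists>x. norm x \<le> norm V * norm z \<and> norm (z - (W + D) x) \<le> norm z / 2 \<and> (W + D) x \<in> UNIV" for z
    using DV[of z] by (intro exI[of _ "V z"]) (simp add: blinfun.add_left inverse_ops_apply[OF WV] norm_blinfun)
  from successive_approximation[OF norm_ge_zero subspace_UNIV this UNIV_I]
  obtain x where "(W + D) x = y" "norm x \<le> 2 * norm V * norm y" .
  then show "\<exists>x. (W + D) x = y \<and> norm x \<le> 2 * norm V * norm y" by blast
next
  fix x assume "(W + D) x = 0"
  then have "D x = - W x" by (simp add: blinfun.add_left eq_neg_iff_add_eq_0 add.commute)
  then have "V (D x) = - x" by (simp add: blinfun.minus_right inverse_ops_apply[OF WV])
  then have "norm x \<le> norm V * (norm D * norm x)"
    using order_trans[OF norm_blinfun[of V "D x"] mult_left_mono[OF norm_blinfun[of D x] norm_ge_zero[of V]]]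
    by simp
  also have "\<dots> \<le> 1/2 * norm x" using mult_right_mono[OF small, of "norm x"] by (simp add: ac_simps)
  finally show "x = 0" by simp
qed (rule that)

subsection \<open>Finite-rank perturbations of invertible operators\<close>

definition finite_rank :: "('a::cbanach \<Rightarrow>\<^sub>L 'a) \<Rightarrow> bool" where
  "finite_rank F \<longleftrightarrow> clinear_op F \<and> (\<exists>B. finite B \<and> range F \<subseteq> cspan B)"

lemma finite_rank_clinear: "finite_rank F \<Longrightarrow> clinear_op F"
  by (simp add: finite_rank_def)

lemma finite_rankI: "clinear_op F \<Longrightarrow> finite B \<Longrightarrow> (\<And>x. F x \<in> cspan B) \<Longrightarrow> finite_rank F"
  by (auto simp: finite_rank_def)

lemma finite_rank_zero: "finite_rank 0"
  by (rule finite_rankI[of _ "{}"]) (simp_all add: clinear_op_zero)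

lemma finite_rank_rank_one:
  assumes "bounded_linear f" "\<And>c x. f (scaleC c x) = c * f x"
  shows "finite_rank (rank_one f g)"
  by (rule finite_rankI[of _ "{g}"])
    (simp_all add: rank_one_apply[OF assms(1)] clinear_op_def assms(2) scaleC_scaleC C.span_base C.span_scale)

lemma finite_rank_add:
  assumes "finite_rank F" "finite_rank G"
  shows "finite_rank (F + G)"
proof -
  obtain B B' where B: "finite B" "range F \<subseteq> cspan B" "finite B'" "range G \<subseteq> cspan B'"
    using assms by (auto simp: finite_rank_def)
  show ?thesis
  proof (rule finite_rankI[of _ "B \<union> B'"])
    show "(F + G) x \<in> cspan (B \<union> B')" for x
      using B C.span_mono[of B "B \<union> B'"] C.span_mono[of B' "B \<union> B'"]
      by (auto simp: blinfun.add_left intro!: C.span_add)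
  qed (use assms B in \<open>auto intro: clinear_op_add finite_rank_clinear\<close>)
qed

lemma finite_rank_compose_left:
  assumes "finite_rank F" "clinear_op A"
  shows "finite_rank (A o\<^sub>L F)"
proof -
  obtain B where B: "finite B" "range F \<subseteq> cspan B" using assms by (auto simp: finite_rank_def)
  have "A ` cspan B = cspan (A ` B)"
    using module_hom.span_image[OF clinear_op_module_hom[OF assms(2)]] by simp
  then have "A (F x) \<in> cspan (A ` B)" for x using B(2) by blast
  then show ?thesis
    using B(1) assms by (intro finite_rankI[of _ "A ` B"]) (auto intro: clinear_op_compose finite_rank_clinear)
qed

lemma finite_rank_compose_right:
  assumes "finite_rank F" "clinear_op A"
  shows "finite_rank (F o\<^sub>L A)"
  using assms by (auto simp: finite_rank_def clinear_op_compose)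

lemma finite_rank_minus:
  assumes "finite_rank F"
  shows "finite_rank (- F)"
proof -
  obtain B where B: "finite B" "range F \<subseteq> cspan B" using assms by (auto simp: finite_rank_def)
  show ?thesis
    by (rule finite_rankI[OF clinear_op_minus[OF finite_rank_clinear[OF assms]] B(1)])
      (use B(2) in \<open>auto simp: blinfun.minus_left intro!: C.span_neg\<close>)
qed

lemma finite_rank_diff: "finite_rank F \<Longrightarrow> finite_rank G \<Longrightarrow> finite_rank (F - G)"
  using finite_rank_add[OF _ finite_rank_minus, of F G] by simp

lemma subspace_finite_rank: "subspace {F. finite_rank F}"
proof (rule subspaceI)
  fix c :: real and F :: "'a \<Rightarrow>\<^sub>L 'a" assume "F \<in> {F. finite_rank F}"
  then have "finite_rank ((c *\<^sub>R id_blinfun) o\<^sub>L F)"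
    by (intro finite_rank_compose_left clinear_op_scaleR clinear_op_id) simp
  moreover have "(c *\<^sub>R id_blinfun) o\<^sub>L F = c *\<^sub>R F" by (rule blinfun_eqI) (simp add: blinfun.scaleR_left)
  ultimately show "c *\<^sub>R F \<in> {F. finite_rank F}" by simp
qed (auto simp: finite_rank_zero finite_rank_add)

text \<open>These are the Fredholm operators of index 0; in this form stability under finite-rank
  perturbations is immediate.\<close>

definition index_zero :: "('a::cbanach \<Rightarrow>\<^sub>L 'a) \<Rightarrow> bool" where
  "index_zero A \<longleftrightarrow> (\<exists>W V F. inverse_ops W V \<and> finite_rank F \<and> A = W + F)"

lemma index_zero_clinear: "index_zero A \<Longrightarrow> clinear_op A"
  by (auto simp: index_zero_def intro: clinear_op_add inverse_ops_clinear finite_rank_clinear)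

lemma index_zero_add_finite_rank: "index_zero A \<Longrightarrow> finite_rank F \<Longrightarrow> index_zero (A + F)"
  unfolding index_zero_def by (elim exE conjE) (auto simp: add.assoc intro: finite_rank_add)

lemma index_zero_inverse_ops: "inverse_ops A B \<Longrightarrow> index_zero A"
  unfolding index_zero_def using finite_rank_zero by (metis add.right_neutral)

lemma finite_subspace_basis:
  fixes S :: "'a::cbanach set"
  assumes S: "C.subspace S" and B: "finite B" "S \<subseteq> cspan B"
  obtains b where "finite b" "C.independent b" "b \<subseteq> S" "cspan b = S"
proof -
  obtain b where b: "b \<subseteq> S" "C.independent b" "S \<subseteq> cspan b" using C.maximal_independent_subset by blast
  have "finite b" using C.independent_span_bound[OF B(1) b(2)] b(1) B(2) by blast
  moreover have "cspan b = S" using b(1,3) S by (rule C.span_subspace)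
  ultimately show thesis using that b by blast
qed

text \<open>A basis of \<open>S\<close> is sent to an independent subset of \<open>S\<close> of the
  same size; a missed vector could be adjoined to it, exceeding the dimension.\<close>

lemma finite_dim_inj_imp_surj:
  fixes S :: "'a::cbanach set"
  assumes f: "module_hom scaleC scaleC f" and S: "C.subspace S" and B: "finite B" "S \<subseteq> cspan B"
    and fS: "f ` S \<subseteq> S" and inj: "\<And>x. x \<in> S \<Longrightarrow> f x = 0 \<Longrightarrow> x = 0"
  shows "f ` S = S"
proof -
  obtain b where b: "finite b" "C.independent b" "b \<subseteq> S" "cspan b = S"
    using finite_subspace_basis[OF S B] by blast
  have inj': "inj_on f S" using module_hom.inj_on_iff_eq_0[OF f S] inj by blast
  have ind: "C.independent (f ` b)"
    using module_hom.independent_injective_image[OF f b(2)] inj' b(4) by simp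
  have card: "card (f ` b) = card b" by (rule card_image[OF inj_on_subset[OF inj' b(3)]])
  have sp: "f ` S = cspan (f ` b)" using module_hom.span_image[OF f, of b] b(4) by simp
  have "S \<subseteq> f ` S"
  proof (rule ccontr)
    assume "\<not> S \<subseteq> f ` S"
    then obtain y where y: "y \<in> S" "y \<notin> cspan (f ` b)" using sp by blast
    have "C.independent (insert y (f ` b))" using y(2) ind by (rule C.independent_insertI)
    moreover have "insert y (f ` b) \<subseteq> cspan b" using y(1) b(3,4) fS by blast
    ultimately have "card (insert y (f ` b)) \<le> card b" using C.independent_span_bound[OF b(1)] by blast
    moreover have "y \<notin> f ` b" using y(2) C.span_base[of y "f ` b"] by argo
    ultimately show False using b(1) card by simp
  qed
  with fS show ?thesis by blast
qed

text \<open>A coincidence or dependence among the images of a basis would leave a spanning set that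
  is too small.\<close>

lemma finite_dim_surj_imp_inj:
  fixes S :: "'a::cbanach set"
  assumes f: "module_hom scaleC scaleC f" and S: "C.subspace S" and B: "finite B" "S \<subseteq> cspan B"
    and fS: "f ` S = S" and x: "x \<in> S" "f x = 0"
  shows "x = 0"
proof -
  obtain b where b: "finite b" "C.independent b" "b \<subseteq> S" "cspan b = S"
    using finite_subspace_basis[OF S B] by blast
  have sp: "cspan (f ` b) = S" using module_hom.span_image[OF f, of b] b(4) fS by simp
  have card_le: "card b \<le> card t" if "finite t" "cspan t = S" for t
    using C.independent_span_bound[OF that(1) b(2)] b(3) that(2) by blast
  have "card (f ` b) = card b"
    using card_le[of "f ` b"] card_image_le[OF b(1), of f] sp b(1) by simp
  then have injb: "inj_on f b" using b(1) by (simp add: eq_card_imp_inj_on)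
  have "C.independent (f ` b)"
  proof
    assume "C.dependent (f ` b)"
    then obtain a where a: "a \<in> f ` b" "a \<in> cspan (f ` b - {a})" unfolding C.dependent_def by blast
    have "cspan (f ` b - {a}) = S" using C.span_redundant[OF a(2)] a(1) sp by (simp add: insert_absorb)
    then have "card b \<le> card (f ` b - {a})" using card_le[of "f ` b - {a}"] b(1) by simp
    then show False using a(1) b(1) \<open>card (f ` b) = card b\<close>
      by (metis card_Diff1_less finite_imageI not_le)
  qed
  then have "inj_on f S"
    using module_hom.inj_on_span_iff_independent_image[OF f] injb b(4) by metis
  then show "x = 0" using module_hom.inj_on_iff_eq_0[OF f S] x by blast
qed

text \<open>The Fredholm alternative. Since \<open>A\<close> is \<open>W\<close> composed with
  \<open>G = id_blinfun + K\<close>, where \<open>K\<close> has finite rank, both properties reduce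
  to the restriction of \<open>G\<close> to the finite-dimensional range of
  \<open>K\<close>.\<close>

lemma index_zero_inj_iff_surj:
  assumes "index_zero A"
  shows "(\<forall>x. A x = 0 \<longrightarrow> x = 0) \<longleftrightarrow> range A = UNIV"
proof -
  obtain W V F where WV: "inverse_ops W V" and F: "finite_rank F" and A: "A = W + F"
    using assms by (auto simp: index_zero_def)
  define K where "K = V o\<^sub>L F"
  have K: "finite_rank K" unfolding K_def by (rule finite_rank_compose_left[OF F inverse_ops_clinear(2)[OF WV]])
  define G where "G = id_blinfun + K"
  have G: "clinear_op G" unfolding G_def by (intro clinear_op_add clinear_op_id finite_rank_clinear K)
  have Gx: "G x = x + K x" for x by (simp add: G_def blinfun.add_left)
  have AG: "A x = W (G x)" for x
    by (simp add: A Gx K_def blinfun.add_left blinfun.add_right inverse_ops_apply[OF WV])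
  define S where "S = range K"
  have S: "C.subspace S" unfolding S_def by (rule csubspace_range[OF finite_rank_clinear[OF K]])
  obtain B where B: "finite B" "S \<subseteq> cspan B" using K by (auto simp: finite_rank_def S_def)
  have KS: "K x \<in> S" for x by (simp add: S_def)
  have GS: "G ` S \<subseteq> S" using C.subspace_add[OF S] KS by (auto simp: Gx)
  note hom = clinear_op_module_hom[OF G]
  have W0: "W y = 0 \<longleftrightarrow> y = 0" for y by (metis blinfun.zero_right inverse_ops_apply(2)[OF WV])
  have inj_G: "(\<forall>x. A x = 0 \<longrightarrow> x = 0) \<longleftrightarrow> (\<forall>x. G x = 0 \<longrightarrow> x = 0)" by (simp add: AG W0)
  have surj_G: "range A = UNIV \<longleftrightarrow> range G = UNIV"
  proof
    assume r: "range A = UNIV"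
    show "range G = UNIV"
    proof (intro equalityI subset_UNIV subsetI)
      fix y
      obtain x where "W y = A x" using r by blast
      then have "y = G x" by (metis AG inverse_ops_apply(2)[OF WV])
      then show "y \<in> range G" by blast
    qed
  next
    assume r: "range G = UNIV"
    show "range A = UNIV"
    proof (intro equalityI subset_UNIV subsetI)
      fix y
      obtain x where "V y = G x" using r by blast
      then have "y = A x" by (metis AG inverse_ops_apply(1)[OF WV])
      then show "y \<in> range A" by blast
    qed
  qed
  have "(\<forall>x. G x = 0 \<longrightarrow> x = 0) \<longleftrightarrow> range G = UNIV"
  proof
    assume inj: "\<forall>x. G x = 0 \<longrightarrow> x = 0"
    have im: "G ` S = S" by (rule finite_dim_inj_imp_surj[OF hom S B GS]) (use inj in blast)
    show "range G = UNIV"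
    proof (intro equalityI subset_UNIV subsetI)
      fix y
      obtain r where r: "r \<in> S" "K y = G r" using KS[of y] im by blast
      have "G (y - r) = y" by (simp add: blinfun.diff_right flip: r(2)) (simp add: Gx)
      then show "y \<in> range G" by (metis rangeI)
    qed
  next
    assume surj: "range G = UNIV"
    have "S \<subseteq> G ` S"
    proof
      fix s assume s: "s \<in> S"
      obtain x where x: "s = G x" using surj by blast
      then have "x = s - K x" by (simp add: Gx)
      then have "x \<in> S" using C.subspace_diff[OF S s KS[of x]] by simp
      with x show "s \<in> G ` S" by blast
    qed
    then have im: "G ` S = S" using GS by blast
    show "\<forall>x. G x = 0 \<longrightarrow> x = 0"
    proof (intro allI impI)
      fix x assume "G x = 0"
      then have "x = - K x" by (simp add: Gx eq_neg_iff_add_eq_0)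
      then have "x \<in> S" using C.subspace_neg[OF S KS[of x]] by simp
      then show "x = 0" using finite_dim_surj_imp_inj[OF hom S B im _ \<open>G x = 0\<close>] by blast
    qed
  qed
  with inj_G surj_G show ?thesis by simp
qed

lemma index_zero_semi_fredholm:
  assumes "index_zero A"
  shows "semi_fredholm (blinfun_apply A)"
proof -
  obtain W V F where WV: "inverse_ops W V" and F: "finite_rank F" and A: "A = W + F"
    using assms by (auto simp: index_zero_def)
  note Wc = inverse_ops_clinear(1)[OF WV] and Vc = inverse_ops_clinear(2)[OF WV] and Fc = finite_rank_clinear[OF F]
  note Ac = index_zero_clinear[OF assms]
  obtain B where B: "finite B" "range F \<subseteq> cspan B" using F by (auto simp: finite_rank_def)
  have "kernel A \<subseteq> cspan (V ` B)"
  proof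
    fix x assume "x \<in> kernel A"
    then have "W x = F (- x)"
      by (simp add: kernel_def A blinfun.add_left blinfun.minus_right eq_neg_iff_add_eq_0)
    then have "x = V (F (- x))" by (metis inverse_ops_apply(2)[OF WV])
    moreover have "V ` cspan B = cspan (V ` B)"
      using module_hom.span_image[OF clinear_op_module_hom[OF Vc]] by simp
    ultimately show "x \<in> cspan (V ` B)" using B(2) by blast
  qed
  from finite_subspace_basis[OF csubspace_kernel[OF Ac] finite_imageI[OF B(1)] this]
  obtain b where "finite b" "cspan b = kernel A" by metis
  then have "nullity A \<noteq> \<infinity>" by (auto simp: nullity_def dim_sub_def)
  obtain b where b: "finite b" "b \<subseteq> range F" "cspan b = range F"
    using finite_subspace_basis[OF csubspace_range[OF Fc] B] by metis
  \<comment> \<open>Preimages of a basis of the range of \<open>F\<close>; together with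
    \<open>kernel F\<close> they span the whole space.\<close>
  obtain G where G: "finite G" "F ` G = b" using finite_subset_image[OF b(1,2)] by blast
  have FG: "F ` cspan G = range F"
    using module_hom.span_image[OF clinear_op_module_hom[OF Fc], of G] G(2) b(3) by simp
  have "range A = cspan (W ` kernel F \<union> A ` G)"
  proof (rule equalityI)
    show "range A \<subseteq> cspan (W ` kernel F \<union> A ` G)"
    proof
      fix y assume "y \<in> range A"
      then obtain x where y: "y = A x" by blast
      obtain g where g: "g \<in> cspan G" "F x = F g" using FG by blast
      then have k: "x - g \<in> kernel F" by (simp add: kernel_def blinfun.diff_right)
      have "A (x - g) = W (x - g)" using k by (simp add: A blinfun.add_left kernel_def)
      then have y': "y = W (x - g) + A g" by (simp add: y blinfun.diff_right diff_eq_eq)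
      have "A g \<in> cspan (A ` G)"
        using g(1) module_hom.span_image[OF clinear_op_module_hom[OF Ac], of G] by blast
      then have "A g \<in> cspan (W ` kernel F \<union> A ` G)" using C.span_mono[of "A ` G" "W ` kernel F \<union> A ` G"] by blast
      moreover have "W (x - g) \<in> cspan (W ` kernel F \<union> A ` G)" using k by (intro C.span_base) blast
      ultimately show "y \<in> cspan (W ` kernel F \<union> A ` G)" unfolding y' by (intro C.span_add)
    qed
    have "W ` kernel F \<subseteq> range A"
    proof
      fix y assume "y \<in> W ` kernel F"
      then obtain x where "y = W x" "F x = 0" by (auto simp: kernel_def)
      then have "y = A x" by (simp add: A blinfun.add_left)
      then show "y \<in> range A" by blast
    qed
    then show "cspan (W ` kernel F \<union> A ` G) \<subseteq> range A"
      by (intro C.span_minimal csubspace_range[OF Ac]) auto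
  qed
  moreover have "closed (cspan (W ` kernel F \<union> A ` G))"
  proof (rule closed_span_Un_finite)
    have "W ` kernel F = (F o\<^sub>L V) -` {0}"
    proof (intro equalityI subsetI)
      fix y assume "y \<in> (F o\<^sub>L V) -` {0}"
      then have "V y \<in> kernel F" by (simp add: kernel_def)
      then show "y \<in> W ` kernel F" by (metis image_eqI inverse_ops_apply(1)[OF WV])
    qed (auto simp: kernel_def inverse_ops_apply[OF WV])
    moreover have "closed ((F o\<^sub>L V) -` {0})"
      by (intro continuous_closed_vimage linear_continuous_at blinfun.bounded_linear_right) simp
    ultimately show "closed (W ` kernel F)" by simp
    show "C.subspace (W ` kernel F)"
      by (rule module_hom.subspace_image[OF clinear_op_module_hom[OF Wc] csubspace_kernel[OF Fc]])
  qed (use G in simp)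
  ultimately show ?thesis using \<open>nullity A \<noteq> \<infinity>\<close> by (simp add: semi_fredholm_def)
qed

subsection \<open>Semi-Fredholm limits of index-zero operators\<close>

definition index_zero_limit :: "('a::cbanach \<Rightarrow>\<^sub>L 'a) \<Rightarrow> bool" where
  "index_zero_limit A \<longleftrightarrow> clinear_op A \<and> (\<forall>e>0. \<exists>G. index_zero G \<and> norm (A - G) < e)"

lemma index_zero_limit_add_finite_rank:
  assumes "index_zero_limit A" "finite_rank F"
  shows "index_zero_limit (A + F)"
  unfolding index_zero_limit_def
proof (intro conjI allI impI)
  show "clinear_op (A + F)"
    using assms by (intro clinear_op_add) (auto simp: index_zero_limit_def finite_rank_clinear)
  fix e :: real assume "e > 0"
  then obtain G where G: "index_zero G" "norm (A - G) < e" using assms(1) by (auto simp: index_zero_limit_def)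
  show "\<exists>G. index_zero G \<and> norm (A + F - G) < e"
    by (intro exI[of _ "G + F"] conjI index_zero_add_finite_rank G(1) assms(2)) (use G(2) in simp)
qed

text \<open>A nearby \<open>G\<close> is still bounded below, by \<open>c / 2\<close>; the Fredholm
  alternative makes it invertible with inverse of norm at most \<open>2 / c\<close>. The distance
  \<open>c / 4\<close> is then small enough to perturb back to \<open>A\<close>.\<close>

lemma index_zero_limit_bounded_below:
  assumes A: "index_zero_limit A" and c: "0 < c" "\<And>x. c * norm x \<le> norm (A x)"
  shows "\<exists>B. inverse_ops A B"
proof -
  obtain G where G: "index_zero G" "norm (A - G) < c / 4"
    using A c(1) unfolding index_zero_limit_def by (meson divide_pos_pos zero_less_numeral)
  have below: "c / 2 * norm x \<le> norm (G x)" for x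
  proof -
    have "norm (A x - G x) \<le> c / 4 * norm x"
      using order_trans[OF norm_blinfun[of "A - G" x] mult_right_mono[OF less_imp_le[OF G(2)] norm_ge_zero[of x]]]
      by (simp add: blinfun.diff_left)
    moreover have "norm (A x) \<le> norm (A x - G x) + norm (G x)" by (metis diff_add_cancel norm_triangle_ineq)
    moreover have "0 \<le> c * norm x" using c(1) by simp
    ultimately show ?thesis using c(2)[of x] by (simp add: field_simps)
  qed
  have inj: "x = 0" if "G x = 0" for x
    using below[of x] that c(1) by (simp add: mult_le_0_iff)
  then have "range G = UNIV" by (intro iffD1[OF index_zero_inj_iff_surj[OF G(1)]] allI impI)
  have Gsurj: "\<exists>x. G x = y \<and> norm x \<le> 2 / c * norm y" for y
  proof -
    obtain x where "G x = y" using \<open>range G = UNIV\<close> by (metis UNIV_I imageE)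
    then show ?thesis using below[of x] c(1) by (auto simp: field_simps)
  qed
  have "0 \<le> 2 / c" using c(1) by simp
  from inverse_ops_of_bijective[OF index_zero_clinear[OF G(1)] this Gsurj inj]
  obtain V where V: "inverse_ops G V" "norm V \<le> 2 / c" .
  have "norm (A - G) * norm V \<le> c / 4 * (2 / c)"
    using G(2) V(2) c(1) by (intro mult_mono) auto
  also have "\<dots> = 1/2" using c(1) by simp
  finally have "norm (A - G) * norm V \<le> 1/2" .
  moreover have "clinear_op (A - G)"
    using A index_zero_clinear[OF G(1)] by (auto simp: index_zero_limit_def intro: clinear_op_diff)
  ultimately obtain V' where "inverse_ops (G + (A - G)) V'" using inverse_ops_perturb[OF V(1)] by metis
  then show ?thesis by auto
qed

text \<open>Solutions for \<open>A\<close> are approximate solutions for a nearby \<open>G\<close>,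
  so \<open>G\<close> is surjective with constant \<open>2 * C\<close>, and the Fredholm alternative
  makes it invertible. The distance \<open>1 / (4 * C)\<close> again allows perturbing back to
  \<open>A\<close>.\<close>

lemma index_zero_limit_surjective:
  assumes A: "index_zero_limit A" and surj: "range A = UNIV"
  shows "\<exists>B. inverse_ops A B"
proof -
  obtain C0 where C0: "0 \<le> C0" "\<And>y. \<exists>x. A x = y \<and> norm x \<le> C0 * norm y"
    using open_mapping_closed_range[of A] surj by auto
  define C where "C = C0 + 1"
  have C: "0 < C" and CA: "\<exists>x. A x = y \<and> norm x \<le> C * norm y" for y
  proof -
    show "0 < C" using C0(1) by (simp add: C_def)
    obtain x where "A x = y" "norm x \<le> C0 * norm y" using C0(2) by blast
    moreover have "C0 * norm y \<le> C * norm y" by (simp add: C_def mult_right_mono)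
    ultimately show "\<exists>x. A x = y \<and> norm x \<le> C * norm y" by (blast intro: order_trans)
  qed
  obtain G where G: "index_zero G" "norm (A - G) < 1 / (4 * C)"
    using A C unfolding index_zero_limit_def by (meson mult_pos_pos zero_less_divide_1_iff zero_less_numeral)
  have step: "\<exists>x. norm x \<le> C * norm y \<and> norm (y - G x) \<le> norm y / 2 \<and> G x \<in> UNIV" for y
  proof -
    obtain x where x: "A x = y" "norm x \<le> C * norm y" using CA by blast
    have "norm (y - G x) \<le> norm (A - G) * norm x"
      using norm_blinfun[of "A - G" x] by (simp add: blinfun.diff_left x(1))
    also have "\<dots> \<le> 1 / (4 * C) * (C * norm y)" using G(2) x(2) C by (intro mult_mono) auto
    also have "\<dots> \<le> norm y / 2" using C by simp
    finally show ?thesis using x(2) by blast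
  qed
  have Gsurj: "\<exists>x. G x = y \<and> norm x \<le> 2 * C * norm y" for y
  proof -
    from successive_approximation[OF less_imp_le[OF C] subspace_UNIV step UNIV_I]
    obtain x where "G x = y" "norm x \<le> 2 * C * norm y" .
    then show ?thesis by blast
  qed
  then have "range G = UNIV" by (metis surjI)
  with index_zero_inj_iff_surj[OF G(1)] have "\<forall>x. G x = 0 \<longrightarrow> x = 0" by (simp only:)
  then have inj: "\<And>x. G x = 0 \<Longrightarrow> x = 0" by simp
  have "0 \<le> 2 * C" using C by simp
  from inverse_ops_of_bijective[OF index_zero_clinear[OF G(1)] this Gsurj inj]
  obtain V where V: "inverse_ops G V" "norm V \<le> 2 * C" .
  have "norm (A - G) * norm V \<le> 1 / (4 * C) * (2 * C)"
    using G(2) V(2) C by (intro mult_mono) auto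
  also have "\<dots> = 1/2" using C by simp
  finally have "norm (A - G) * norm V \<le> 1/2" .
  moreover have "clinear_op (A - G)"
    using A index_zero_clinear[OF G(1)] by (auto simp: index_zero_limit_def intro: clinear_op_diff)
  ultimately obtain V' where "inverse_ops (G + (A - G)) V'" using inverse_ops_perturb[OF V(1)] by metis
  then show ?thesis by auto
qed

lemma closed_range_injective_bounded_below:
  fixes A :: "'v::banach \<Rightarrow>\<^sub>L 'w::banach"
  assumes cl: "closed (range A)" and inj: "\<And>x. A x = 0 \<Longrightarrow> x = 0"
  obtains c where "0 < c" "\<And>x. c * norm x \<le> norm (A x)"
proof -
  obtain C where C: "0 \<le> C" "\<And>y. y \<in> range A \<Longrightarrow> \<exists>x. A x = y \<and> norm x \<le> C * norm y"
    using open_mapping_closed_range[OF cl] by blast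
  have le: "norm x \<le> (C + 1) * norm (A x)" for x
  proof -
    obtain x' where x': "A x' = A x" "norm x' \<le> C * norm (A x)" using C(2)[of "A x"] by blast
    then have "x' = x" using inj[of "x' - x"] by (simp add: blinfun.diff_right)
    with x' show ?thesis by (simp add: distrib_right add_increasing2)
  qed
  show thesis
  proof (rule that[of "1 / (C + 1)"])
    show "1 / (C + 1) * norm x \<le> norm (A x)" for x
      using le[of x] C(1) by (simp add: field_simps)
  qed (use C(1) in simp)
qed

section \<open>Exchange, dimension and codimension\<close>

lemma span_Un_exchange:
  fixes M :: "'a::cbanach set"
  assumes "finite F" "C.subspace M" "g \<in> cspan (M \<union> F)" "g \<notin> M"
  shows "\<exists>h\<in>F. h \<in> cspan (insert g M \<union> (F - {h}))"
  using assms
proof (induction F rule: finite_induct)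
  case empty
  have "cspan M = M" using empty(1) by simp
  with empty show ?case by (metis Un_empty_right)
next
  case (insert a F)
  show ?case
  proof (cases "g \<in> cspan (M \<union> F)")
    case True
    then obtain h where h: "h \<in> F" "h \<in> cspan (insert g M \<union> (F - {h}))" using insert by blast
    have "insert g M \<union> (F - {h}) \<subseteq> insert g M \<union> (insert a F - {h})" by blast
    then show ?thesis using h C.span_mono by blast
  next
    case False
    have "g \<in> cspan (insert a (M \<union> F))" using insert.prems by simp
    from C.in_span_insert[OF this False] have "a \<in> cspan (insert g M \<union> (insert a F - {a}))"
      using insert.hyps(2) by simp
    then show ?thesis by blast
  qed
qed

text \<open>Steinitz exchange relative to \<open>M\<close>: \<open>h\<close> is redundant once
  \<open>g\<close> is adjoined. This supplies the lower bound for codimensions and the counts in the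
  induction on nullity or defect.\<close>

lemma span_Un_exchange_subset:
  fixes M :: "'a::cbanach set"
  assumes "finite F" "C.subspace M" "g \<in> cspan (M \<union> F)" "g \<notin> M"
  obtains h where "h \<in> F" "cspan (M \<union> F) \<subseteq> cspan (insert g M \<union> (F - {h}))"
proof -
  obtain h where h: "h \<in> F" "h \<in> cspan (insert g M \<union> (F - {h}))" using span_Un_exchange[OF assms] by blast
  have "M \<union> F \<subseteq> insert h (insert g M \<union> (F - {h}))" by blast
  then have "cspan (M \<union> F) \<subseteq> cspan (insert h (insert g M \<union> (F - {h})))" by (rule C.span_mono)
  then have "cspan (M \<union> F) \<subseteq> cspan (insert g M \<union> (F - {h}))" unfolding C.span_redundant[OF h(2)] .
  with h(1) show thesis by (rule that)
qed

lemma dim_sub_span_independent: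
  fixes b :: "'a::cbanach set"
  assumes "finite b" "C.independent b"
  shows "dim_sub (cspan b) = enat (card b)"
proof -
  have "C.dim (cspan b) = card b" using assms(2) by (rule C.dim_span_eq_card_independent)
  then show ?thesis using assms(1) by (auto simp: dim_sub_def)
qed

lemma dim_sub_insert:
  fixes M :: "'a::cbanach set"
  assumes M: "C.subspace M" and k: "dim_sub M = enat k" and e: "e \<notin> M"
  shows "dim_sub (cspan (insert e M)) = enat (Suc k)"
proof -
  obtain B where "finite B" "cspan B = M" using k by (auto simp: dim_sub_def split: if_splits)
  then obtain b where b: "finite b" "C.independent b" "cspan b = M"
    using finite_subspace_basis[OF M, of B] by (metis order_refl)
  have "card b = k" using dim_sub_span_independent[OF b(1,2)] k b(3) by simp
  moreover have "C.independent (insert e b)" using e b(2,3) by (simp add: C.independent_insertI)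
  moreover have "e \<notin> b" using e b(3) C.span_base[of e b] by blast
  moreover have "cspan (insert e b) = cspan (insert e M)"
    using C.span_Un[of "{e}" b] C.span_Un[of "{e}" M] C.span_span[of b] unfolding b(3) by simp
  ultimately show ?thesis using dim_sub_span_independent[of "insert e b"] b(1) by simp
qed

lemma codim_sub_eqI:
  fixes M :: "'a::cbanach set"
  assumes "finite F" "card F = k" "cspan (M \<union> F) = UNIV"
    and min: "\<And>F. finite F \<Longrightarrow> cspan (M \<union> F) = UNIV \<Longrightarrow> k \<le> card F"
  shows "codim_sub M = enat k"
  unfolding codim_sub_def
proof (rule order_antisym)
  show "(INF F\<in>{F. finite F \<and> cspan (M \<union> F) = UNIV}. enat (card F)) \<le> enat k"
    by (rule INF_lower2[of F]) (use assms in auto)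
  show "enat k \<le> (INF F\<in>{F. finite F \<and> cspan (M \<union> F) = UNIV}. enat (card F))"
    by (rule INF_greatest) (use min in auto)
qed

text \<open>A finite infimum of extended naturals comes from a nonempty set and is attained.\<close>

lemma codim_sub_finite:
  fixes M :: "'a::cbanach set"
  assumes "codim_sub M = enat k"
  obtains F where "finite F" "card F = k" "cspan (M \<union> F) = UNIV"
proof -
  let ?S = "(\<lambda>F. enat (card F)) ` {F. finite F \<and> cspan (M \<union> F) = UNIV}"
  have "?S \<noteq> {}" using assms by (auto simp: codim_sub_def Inf_enat_def split: if_splits)
  then have "Inf ?S \<in> ?S" unfolding Inf_enat_def by (metis (mono_tags, lifting) LeastI_ex ex_in_conv)
  then show thesis using assms that by (auto simp: codim_sub_def)
qed

lemma codim_sub_le: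
  fixes M :: "'a::cbanach set"
  assumes "finite F" "cspan (M \<union> F) = UNIV"
  shows "codim_sub M \<le> enat (card F)"
  unfolding codim_sub_def by (rule INF_lower2[of F]) (use assms in auto)

lemma span_span_insert_Un:
  fixes M :: "'a::cbanach set"
  shows "cspan (cspan (insert g M) \<union> F) = cspan (insert g M \<union> F)"
  by (simp only: C.span_Un C.span_span)

text \<open>Adding \<open>g\<close> to a smallest complement of the larger subspace gives the upper
  bound. For the lower bound, \<open>g\<close> is exchanged for a member of an arbitrary finite
  complement of \<open>M\<close>.\<close>

lemma codim_sub_insert:
  fixes M :: "'a::cbanach set"
  assumes M: "C.subspace M" and k: "codim_sub (cspan (insert g M)) = enat k" and g: "g \<notin> M"
  shows "codim_sub M = enat (Suc k)"
proof -
  obtain F where F: "finite F" "card F = k" "cspan (cspan (insert g M) \<union> F) = UNIV"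
    using codim_sub_finite[OF k] by blast
  have span: "cspan (M \<union> insert g F) = UNIV" using F(3) by (simp add: span_span_insert_Un)
  have min: "Suc k \<le> card H" if H: "finite H" "cspan (M \<union> H) = UNIV" for H
  proof -
    have "g \<in> cspan (M \<union> H)" using H(2) by simp
    then obtain h where h: "h \<in> H" "cspan (M \<union> H) \<subseteq> cspan (insert g M \<union> (H - {h}))"
      using span_Un_exchange_subset[OF H(1) M _ g] by metis
    then have "cspan (cspan (insert g M) \<union> (H - {h})) = UNIV" using H(2) by (auto simp: span_span_insert_Un)
    then have "k \<le> card (H - {h})" using codim_sub_le[of "H - {h}" "cspan (insert g M)"] k H(1) by simp
    then show ?thesis using h(1) H(1) by (metis Suc_le_mono card_Suc_Diff1)
  qed
  have "card (insert g F) \<le> Suc k" using F(1,2) by (simp add: card_insert_if)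
  then have "card (insert g F) = Suc k" using min[OF _ span] F(1) by (simp add: le_antisym)
  then show ?thesis using codim_sub_eqI[OF _ _ span min] F(1) by blast
qed

lemma inverse_ops_nullity_defect:
  assumes "inverse_ops A B"
  shows "nullity A = enat 0" "defect A = enat 0"
proof -
  have "kernel A = {0}"
    using inverse_ops_apply[OF assms] by (auto simp: kernel_def) (metis blinfun.zero_right)
  then have "kernel A = cspan {}" by simp
  then show "nullity A = enat 0"
    unfolding nullity_def using dim_sub_span_independent[of "{}"] C.independent_empty by simp
  have "range A = UNIV" using inverse_ops_apply(1)[OF assms] by (rule surjI)
  then show "defect A = enat 0"
    unfolding defect_def by (intro codim_sub_eqI[of "{}"]) auto
qed

text \<open>Induction on a bound for one of nullity and defect; semi-Fredholmness guarantees that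
  one of them is finite. If the kernel is nonzero and the range proper, a rank-one operator sending
  a kernel vector \<open>e\<close> to a vector \<open>g\<close> outside the range lowers both
  numbers by one and keeps the range closed. The base case is an injective or surjective operator,
  which is invertible.\<close>

lemma semi_fredholm_index_zero_limit_induct:
  assumes "index_zero_limit A" "closed (range A)"
    and "(\<exists>B. finite B \<and> card B \<le> n \<and> kernel A \<subseteq> cspan B)
       \<or> (\<exists>F. finite F \<and> card F \<le> n \<and> cspan (range A \<union> F) = UNIV)"
  shows "index_zero A \<and> (\<exists>k. nullity A = enat k \<and> defect A = enat k)"
  using assms
proof (induction n arbitrary: A)
  case (0 A)
  have Ac: "clinear_op A" using 0(1) by (simp add: index_zero_limit_def)
  have "\<exists>B. inverse_ops A B"
    using 0(3)
  proof
    assume "\<exists>B. finite B \<and> card B \<le> 0 \<and> kernel A \<subseteq> cspan B"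
    then have inj: "x = 0" if "A x = 0" for x using that by (auto simp: kernel_def)
    obtain c where "0 < c" "\<And>x. c * norm x \<le> norm (A x)"
      using closed_range_injective_bounded_below[OF 0(2) inj] by blast
    then show ?thesis by (rule index_zero_limit_bounded_below[OF 0(1)])
  next
    assume "\<exists>F. finite F \<and> card F \<le> 0 \<and> cspan (range A \<union> F) = UNIV"
    then have "cspan (range A) = UNIV" by auto
    moreover have "cspan (range A) = range A" using csubspace_range[OF Ac] by simp
    ultimately show ?thesis using index_zero_limit_surjective[OF 0(1)] by metis
  qed
  then show ?case using inverse_ops_nullity_defect index_zero_inverse_ops by blast
next
  case (Suc n A)
  have Ac: "clinear_op A" using Suc.prems(1) by (simp add: index_zero_limit_def)
  note RA = csubspace_range[OF Ac] and NA = csubspace_kernel[OF Ac]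
  show ?case
  proof (cases "kernel A \<subseteq> {0} \<or> range A = UNIV")
    case True
    \<comment> \<open>One of the alternatives now holds with the empty set, hence also for the
      smaller bound.\<close>
    then have "(\<exists>B. finite B \<and> card B \<le> n \<and> kernel A \<subseteq> cspan B)
       \<or> (\<exists>F. finite F \<and> card F \<le> n \<and> cspan (range A \<union> F) = UNIV)"
    proof
      assume "kernel A \<subseteq> {0}"
      then show ?thesis by (intro disjI1 exI[of _ "{}"]) simp
    next
      assume "range A = UNIV"
      then show ?thesis by (intro disjI2 exI[of _ "{}"]) simp
    qed
    then show ?thesis using Suc.IH[OF Suc.prems(1,2)] by blast
  next
    case False
    then obtain e g where e: "e \<in> kernel A" "e \<noteq> 0" and g: "g \<notin> range A" by blast
    obtain f :: "'a \<Rightarrow> complex" where f: "bounded_linear f" "\<And>c x. f (scaleC c x) = c * f x" "f e = 1"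
      using bounded_functional_vanishing_on[OF closed_singleton C.subspace_single_0, of e] e(2) by (metis singletonD)
    note fdiff = linear_diff[OF bounded_linear.linear[OF f(1)]] and fadd = linear_add[OF bounded_linear.linear[OF f(1)]]
    have Ae: "A e = 0" using e(1) by (simp add: kernel_def)
    define A' where "A' = A + rank_one f g"
    have fin: "finite_rank (rank_one f g)" by (rule finite_rank_rank_one[OF f(1,2)])
    have A'x: "A' x = A x + scaleC (f x) g" for x by (simp add: A'_def blinfun.add_left rank_one_apply[OF f(1)])
    have lim': "index_zero_limit A'"
      unfolding A'_def by (rule index_zero_limit_add_finite_rank[OF Suc.prems(1) fin])
    then have A'c: "clinear_op A'" by (simp add: index_zero_limit_def)
    have ker': "x \<in> kernel A' \<longleftrightarrow> A x = 0 \<and> f x = 0" for x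
    proof
      assume "x \<in> kernel A'"
      then have eq: "A x = - scaleC (f x) g" by (simp add: kernel_def A'x eq_neg_iff_add_eq_0)
      have "f x = 0"
      proof (rule ccontr)
        assume nz: "f x \<noteq> 0"
        have "g = scaleC (- (1 / f x)) (A x)" using nz by (simp add: eq)
        also have "\<dots> \<in> range A" using C.subspace_scale[OF RA] by blast
        finally show False using g by blast
      qed
      then show "A x = 0 \<and> f x = 0" using eq by simp
    qed (simp add: kernel_def A'x)
    have ker: "kernel A = cspan (insert e (kernel A'))"
    proof (intro equalityI subsetI)
      fix x assume "x \<in> kernel A"
      then have "x - scaleC (f x) e \<in> kernel A'"
        by (simp add: ker' fdiff f(2,3) kernel_def[of "blinfun_apply A"] blinfun.diff_right clinear_op_scaleC[OF Ac] Ae)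
      then show "x \<in> cspan (insert e (kernel A'))" by (auto simp: C.span_insert intro: C.span_base)
    next
      fix x assume "x \<in> cspan (insert e (kernel A'))"
      moreover have "cspan (insert e (kernel A')) \<subseteq> kernel A"
        by (intro C.span_minimal NA) (use e(1) in \<open>auto simp: ker' kernel_def[of "blinfun_apply A"]\<close>)
      ultimately show "x \<in> kernel A" by blast
    qed
    have ran: "range A' = cspan (insert g (range A))"
    proof (intro equalityI subsetI)
      fix y assume "y \<in> range A'"
      then obtain x where "y = A x + scaleC (f x) g" by (auto simp: A'x)
      then show "y \<in> cspan (insert g (range A))"
        by (auto intro!: C.span_add C.span_scale intro: C.span_base)
    next
      fix y assume "y \<in> cspan (insert g (range A))"
      moreover have "cspan (range A) = range A" using RA by simp
      ultimately obtain k x where "y - scaleC k g = A x" by (auto simp: C.span_insert)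
      then have y: "y = A x + scaleC k g" by (simp add: diff_eq_eq)
      \<comment> \<open>Moving along \<open>e\<close> leaves \<open>A x\<close> unchanged and sets
        the value of \<open>f\<close>, hence the coefficient of \<open>g\<close>, to
        \<open>k\<close>.\<close>
      have "A' (x + scaleC (k - f x) e) = y"
        by (simp add: A'x y blinfun.add_right clinear_op_scaleC[OF Ac] Ae fadd f(2,3) flip: scaleC_add_left)
      then show "y \<in> range A'" by (metis rangeI)
    qed
    have "closed (range A')" unfolding ran by (rule closed_span_insert[OF Suc.prems(2) RA])
    moreover have "(\<exists>B. finite B \<and> card B \<le> n \<and> kernel A' \<subseteq> cspan B)
       \<or> (\<exists>F. finite F \<and> card F \<le> n \<and> cspan (range A' \<union> F) = UNIV)"
      using Suc.prems(3)
    proof (elim disjE exE conjE)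
      fix B assume B: "finite B" "card B \<le> Suc n" "kernel A \<subseteq> cspan B"
      then have "e \<in> cspan ({0} \<union> B)" using e(1) by auto
      then obtain b where b: "b \<in> B" "cspan ({0} \<union> B) \<subseteq> cspan (insert e {0} \<union> (B - {b}))"
        using span_Un_exchange_subset[OF B(1) C.subspace_single_0, of e] e(2) by blast
      \<comment> \<open>\<open>Q\<close> kills \<open>e\<close> and fixes \<open>kernel A'\<close>,
        where \<open>f\<close> vanishes. After \<open>b\<close> has been exchanged for
        \<open>e\<close>, applying \<open>Q\<close> drops \<open>e\<close> from the spanning
        set.\<close>
      define Q where "Q = id_blinfun - rank_one f e"
      have Qx: "Q x = x - scaleC (f x) e" for x by (simp add: Q_def blinfun.diff_left rank_one_apply[OF f(1)])
      have Q: "clinear_op Q"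
        unfolding Q_def by (intro clinear_op_diff clinear_op_id finite_rank_clinear finite_rank_rank_one f(1,2))
      have Qe: "Q e = 0" by (simp add: Qx f(3))
      have "kernel A' \<subseteq> cspan (Q ` (B - {b}))"
      proof
        fix x assume x: "x \<in> kernel A'"
        then have "x \<in> kernel A" by (simp add: ker' kernel_def[of "blinfun_apply A"])
        then have "x \<in> cspan ({0} \<union> B)" using B(3) by auto
        then have "x \<in> cspan (insert e {0} \<union> (B - {b}))" using b(2) by blast
        then have "Q x \<in> cspan (Q ` (insert e {0} \<union> (B - {b})))"
          using module_hom.span_image[OF clinear_op_module_hom[OF Q]] by blast
        moreover have "Q ` (insert e {0} \<union> (B - {b})) = insert 0 (Q ` (B - {b}))" by (auto simp: Qe)
        moreover have "Q x = x" using x by (simp add: Qx ker')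
        ultimately show "x \<in> cspan (Q ` (B - {b}))" by simp
      qed
      moreover have "card (Q ` (B - {b})) \<le> n"
        using card_image_le[of "B - {b}" Q] B(1,2) b(1) by simp
      ultimately show ?thesis using B(1) by (intro disjI1 exI[of _ "Q ` (B - {b})"]) simp
    next
      fix F assume F: "finite F" "card F \<le> Suc n" "cspan (range A \<union> F) = UNIV"
      obtain h where h: "h \<in> F" "cspan (range A \<union> F) \<subseteq> cspan (insert g (range A) \<union> (F - {h}))"
        using span_Un_exchange_subset[OF F(1) RA _ g] F(3) by blast
      then have "cspan (range A' \<union> (F - {h})) = UNIV" unfolding ran span_span_insert_Un using F(3) by blast
      moreover have "card (F - {h}) \<le> n" using F(1,2) h(1) by simp
      ultimately show ?thesis using F(1) by (intro disjI2 exI[of _ "F - {h}"]) simp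
    qed
    ultimately obtain k where k: "index_zero A'" "nullity A' = enat k" "defect A' = enat k"
      using Suc.IH[OF lim'] by blast
    have "index_zero (A' + - rank_one f g)" by (rule index_zero_add_finite_rank[OF k(1) finite_rank_minus[OF fin]])
    then have "index_zero A" by (simp add: A'_def)
    moreover have "nullity A = enat (Suc k)"
      unfolding nullity_def ker
      by (rule dim_sub_insert[OF csubspace_kernel[OF A'c]]) (use k(2) f(3) in \<open>auto simp: nullity_def ker'\<close>)
    moreover have "defect A = enat (Suc k)"
      unfolding defect_def by (rule codim_sub_insert[OF RA _ g]) (use k(3) in \<open>simp add: defect_def ran\<close>)
    ultimately show ?thesis by blast
  qed
qed

theorem semi_fredholm_index_zero_limit:
  assumes lim: "index_zero_limit A" and sf: "semi_fredholm (blinfun_apply A)"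
  shows "index_zero A" "index_op (blinfun_apply A) = 0"
proof -
  have "\<exists>n. (\<exists>B. finite B \<and> card B \<le> n \<and> kernel A \<subseteq> cspan B)
       \<or> (\<exists>F. finite F \<and> card F \<le> n \<and> cspan (range A \<union> F) = UNIV)"
  proof (cases "nullity A = \<infinity>")
    case False
    then obtain B where "finite B" "cspan B = kernel A" by (auto simp: nullity_def dim_sub_def split: if_splits)
    then show ?thesis by (intro exI[of _ "card B"] disjI1 exI[of _ B]) simp
  next
    case True
    then obtain k where "codim_sub (range A) = enat k" using sf by (auto simp: semi_fredholm_def defect_def)
    then obtain F where "finite F" "cspan (range A \<union> F) = UNIV" using codim_sub_finite by metis
    then show ?thesis by (intro exI[of _ "card F"] disjI2 exI[of _ F]) simp
  qed
  then obtain n where "(\<exists>B. finite B \<and> card B \<le> n \<and> kernel A \<subseteq> cspan B)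
       \<or> (\<exists>F. finite F \<and> card F \<le> n \<and> cspan (range A \<union> F) = UNIV)" by blast
  from semi_fredholm_index_zero_limit_induct[OF lim _ this]
  have *: "index_zero A \<and> (\<exists>k. nullity A = enat k \<and> defect A = enat k)"
    using sf by (simp add: semi_fredholm_def)
  then show "index_zero A" by blast
  from * show "index_op (blinfun_apply A) = 0" by (auto simp: index_op_def)
qed

text \<open>Each step strips one vector \<open>g\<close> by composing with
  \<open>id_blinfun - rank_one f g\<close>, where \<open>f\<close> vanishes on \<open>M\<close> and
  \<open>f g = 1\<close>; the accumulated correction has finite rank.\<close>

lemma finite_codim_projection:
  fixes M :: "'a::cbanach set"
  assumes "finite F" "closed M" "C.subspace M" "cspan (M \<union> F) = UNIV"
  shows "\<exists>P. clinear_op P \<and> range P \<subseteq> M \<and> finite_rank (id_blinfun - P)"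
  using assms
proof (induction F arbitrary: M rule: finite_induct)
  case empty
  have "cspan M = M" using empty(2) by simp
  with empty(3) have "M = UNIV" by simp
  then show ?case by (intro exI[of _ id_blinfun]) (simp add: clinear_op_id finite_rank_zero)
next
  case (insert g F M)
  have "cspan (cspan (insert g M) \<union> F) = UNIV" using insert.prems(3) by (simp add: span_span_insert_Un)
  then obtain P where P: "clinear_op P" "range P \<subseteq> cspan (insert g M)" "finite_rank (id_blinfun - P)"
    using insert.IH[OF closed_span_insert[OF insert.prems(1,2)] C.subspace_span] by blast
  have spM: "cspan M = M" using insert.prems(2) by simp
  show ?case
  proof (cases "g \<in> M")
    case True
    then have "cspan (insert g M) = M" using spM by (simp only: insert_absorb)
    then show ?thesis using P by auto
  next
    case False
    obtain f :: "'a \<Rightarrow> complex" where f: "bounded_linear f" "\<And>c x. f (scaleC c x) = c * f x"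
      "\<And>x. x \<in> M \<Longrightarrow> f x = 0" "f g = 1"
      using bounded_functional_vanishing_on[OF insert.prems(1,2) False] by blast
    have fin: "finite_rank (rank_one f g o\<^sub>L P)"
      by (rule finite_rank_compose_right[OF finite_rank_rank_one[OF f(1,2)] P(1)])
    define P' where "P' = P - (rank_one f g o\<^sub>L P)"
    have "P' x \<in> M" for x
    proof -
      obtain k where k: "P x - scaleC k g \<in> M" using P(2) by (auto simp: C.span_insert spM)
      then have "f (P x) = k"
        using f(3)[OF k] by (simp add: linear_diff[OF bounded_linear.linear[OF f(1)]] f(2,4))
      with k show ?thesis by (simp add: P'_def blinfun.diff_left rank_one_apply[OF f(1)])
    qed
    moreover have "clinear_op P'" unfolding P'_def by (intro clinear_op_diff P(1) finite_rank_clinear fin)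
    moreover have "id_blinfun - P' = (id_blinfun - P) + (rank_one f g o\<^sub>L P)" by (simp add: P'_def)
    then have "finite_rank (id_blinfun - P')" using finite_rank_add[OF P(3) fin] by (simp only:)
    ultimately show ?thesis by blast
  qed
qed

subsection \<open>Resolvents\<close>

lemma inverse_ops_left_right:
  assumes "clinear_op A" "clinear_op B" "\<And>x. A (B x) = x" "\<And>x. B' (A x) = x"
  shows "inverse_ops A B"
  by (rule inverse_opsI) (use assms in metis)+

lemma inverse_ops_shift:
  fixes A :: "'a::cbanach \<Rightarrow>\<^sub>L 'a"
  assumes R: "inverse_ops (A - scal_op w) R" and small: "cmod (w' - w) * norm R \<le> 1/2"
  obtains R' where "inverse_ops (A - scal_op w') R'" "norm R' \<le> 2 * norm R"
proof -
  have "norm (scal_op (w - w') :: 'a \<Rightarrow>\<^sub>L 'a) * norm R \<le> cmod (w' - w) * norm R"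
    using mult_right_mono[OF norm_scal_op_le[where 'a = 'a and c = "w - w'"] norm_ge_zero[of R]]
    by (simp add: norm_minus_commute)
  with small have "norm (scal_op (w - w') :: 'a \<Rightarrow>\<^sub>L 'a) * norm R \<le> 1/2" by simp
  from inverse_ops_perturb[OF R clinear_op_scal this]
  obtain R' where "inverse_ops (A - scal_op w + scal_op (w - w')) R'" "norm R' \<le> 2 * norm R" .
  then show thesis using that by (simp add: scal_op_diff)
qed

lemma open_resolvent_set:
  assumes "clinear_op A"
  shows "open (- spectrum_op A)"
  unfolding open_dist
proof
  fix w assume "w \<in> - spectrum_op A"
  then obtain R where R: "inverse_ops (A - scal_op w) R" using notin_spectrum_iff[OF assms] by blast
  show "\<exists>e>0. \<forall>y. dist y w < e \<longrightarrow> y \<in> - spectrum_op A"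
  proof (intro exI[of _ "1 / (2 * (norm R + 1))"] conjI allI impI)
    show "0 < 1 / (2 * (norm R + 1))" by (simp add: add_nonneg_pos)
    fix y assume "dist y w < 1 / (2 * (norm R + 1))"
    then have "cmod (y - w) * (2 * (norm R + 1)) < 1"
      by (simp add: dist_norm pos_less_divide_eq add_nonneg_pos)
    moreover have "cmod (y - w) * (2 * (norm R + 1)) = 2 * (cmod (y - w) * norm R) + 2 * cmod (y - w)"
      by (simp add: algebra_simps)
    ultimately have "cmod (y - w) * norm R \<le> 1/2" using norm_ge_zero[of "y - w"] by linarith
    from inverse_ops_shift[OF R this] show "y \<in> - spectrum_op A"
      using notin_spectrum_iff[OF assms, of y] by (metis ComplI)
  qed
qed

lemma closed_spectrum: "clinear_op A \<Longrightarrow> closed (spectrum_op A)"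
  using open_resolvent_set by (simp add: closed_def)

text \<open>For larger \<open>w\<close>, \<open>A\<close> is a small perturbation of the invertible
  scalar \<open>- w\<close>. The factor 2 is inherited from the threshold in
  \<open>inverse_ops_perturb\<close>.\<close>

lemma norm_spectrum_le:
  fixes A :: "'a::cbanach \<Rightarrow>\<^sub>L 'a"
  assumes A: "clinear_op A" and w: "w \<in> spectrum_op A"
  shows "cmod w \<le> 2 * norm A"
proof (rule ccontr)
  assume "\<not> cmod w \<le> 2 * norm A"
  then have big: "2 * norm A < cmod w" by simp
  then have w0: "w \<noteq> 0" using norm_ge_zero[of A] by auto
  have inv: "inverse_ops (scal_op (- w) :: 'a \<Rightarrow>\<^sub>L 'a) (scal_op (- 1 / w))"
    by (rule inverse_opsI) (use w0 in \<open>simp_all add: clinear_op_scal\<close>)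
  have "norm A * norm (scal_op (- 1 / w) :: 'a \<Rightarrow>\<^sub>L 'a) \<le> norm A * (1 / cmod w)"
    using norm_scal_op_le[where 'a = 'a and c = "- 1 / w"] by (intro mult_left_mono) (simp_all add: norm_divide)
  moreover have "norm A * (1 / cmod w) \<le> 1/2"
    using big w0 by (simp add: field_simps)
  ultimately have "norm A * norm (scal_op (- 1 / w) :: 'a \<Rightarrow>\<^sub>L 'a) \<le> 1/2" by linarith
  from inverse_ops_perturb[OF inv A this] obtain V where "inverse_ops (scal_op (- w) + A) V" .
  moreover have "scal_op (- w) + A = A - scal_op w"
    by (rule blinfun_eqI) (simp add: blinfun.add_left blinfun.diff_left)
  ultimately show False using w notin_spectrum_iff[OF A] by auto
qed

lemma resolvent_identity:
  assumes "inverse_ops (A - scal_op w) R" "inverse_ops (A - scal_op w') R'"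
  shows "R' - R = scal_op (w' - w) o\<^sub>L (R' o\<^sub>L R)"
proof (rule blinfun_eqI)
  fix x
  have "(A - scal_op w) (R x) = x" by (rule inverse_ops_apply(1)[OF assms(1)])
  then have "(A - scal_op w') (R x) = x - scaleC (w' - w) (R x)"
    by (simp add: blinfun.diff_left C.scale_left_diff_distrib diff_eq_eq)
  then have "R x = R' (x - scaleC (w' - w) (R x))" using inverse_ops_apply(2)[OF assms(2), of "R x"] by simp
  then have "R x = R' x - scaleC (w' - w) (R' (R x))"
    by (simp only: blinfun.diff_right clinear_op_scaleC[OF inverse_ops_clinear(2)[OF assms(2)]])
  then have "R' x - R x = scaleC (w' - w) (R' (R x))" by (simp only: diff_eq_eq eq_diff_eq add.commute)
  then show "(R' - R) x = (scal_op (w' - w) o\<^sub>L (R' o\<^sub>L R)) x"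
    by (simp add: blinfun.diff_left)
qed

text \<open>Off the spectrum this is the unique inverse; on the spectrum the value is
  arbitrary.\<close>

definition resolvent :: "('a::cbanach \<Rightarrow>\<^sub>L 'a) \<Rightarrow> complex \<Rightarrow> 'a \<Rightarrow>\<^sub>L 'a" where
  "resolvent A w = (SOME R. inverse_ops (A - scal_op w) R)"

lemma resolvent: "clinear_op A \<Longrightarrow> w \<notin> spectrum_op A \<Longrightarrow> inverse_ops (A - scal_op w) (resolvent A w)"
  unfolding resolvent_def by (rule someI_ex) (simp add: notin_spectrum_iff)

lemma isCont_resolvent:
  assumes A: "clinear_op A" and w: "w \<notin> spectrum_op A"
  shows "isCont (resolvent A) w"
  unfolding isCont_def
proof (rule LIM_I)
  fix r :: real assume r: "0 < r"
  note R = resolvent[OF A w]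
  define N where "N = norm (resolvent A w)"
  have N: "0 \<le> N" by (simp add: N_def)
  \<comment> \<open>The first bound brings \<open>x\<close> within reach of
    \<open>inverse_ops_shift\<close>, which bounds the new inverse by \<open>2 * N\<close>; the
    second makes the resolvent identity yield less than \<open>r\<close>. The added 1 keeps the
    denominators positive.\<close>
  define s where "s = min (1 / (2 * (N + 1))) (r / (2 * N * N + 1))"
  have s: "0 < s" using r N by (auto simp: s_def intro!: divide_pos_pos add_nonneg_pos)
  show "\<exists>s>0. \<forall>x. x \<noteq> w \<and> norm (x - w) < s \<longrightarrow> norm (resolvent A x - resolvent A w) < r"
  proof (intro exI[of _ s] conjI allI impI s)
    fix x assume x: "x \<noteq> w \<and> norm (x - w) < s"
    then have "cmod (x - w) \<le> 1 / (2 * (N + 1))" by (simp add: s_def)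
    then have "cmod (x - w) * N \<le> 1 / (2 * (N + 1)) * N" using N by (rule mult_right_mono)
    also have "\<dots> \<le> 1/2" using N by (simp add: field_simps)
    finally have "cmod (x - w) * norm (resolvent A w) \<le> 1/2" by (simp add: N_def)
    from inverse_ops_shift[OF R this]
    obtain R' where R': "inverse_ops (A - scal_op x) R'" "norm R' \<le> 2 * N" unfolding N_def .
    then have "x \<notin> spectrum_op A" using notin_spectrum_iff[OF A] by blast
    then have R'_eq: "R' = resolvent A x" using inverse_ops_unique[OF R'(1)] resolvent[OF A] by blast
    have "norm (R' - resolvent A w) \<le> norm (scal_op (x - w) :: 'a \<Rightarrow>\<^sub>L 'a) * norm (R' o\<^sub>L resolvent A w)"
      unfolding resolvent_identity[OF R R'(1)] by (rule norm_blinfun_compose)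
    also have "\<dots> \<le> cmod (x - w) * (2 * N * N)"
      using norm_blinfun_compose[of R' "resolvent A w"] mult_right_mono[OF R'(2) N]
      by (intro mult_mono norm_scal_op_le) (auto simp: N_def)
    also have "\<dots> \<le> cmod (x - w) * (2 * N * N + 1)" by (simp add: mult_left_mono)
    also have "\<dots> < r"
    proof -
      have "0 < 2 * N * N + 1" using N by (intro add_nonneg_pos) auto
      then show ?thesis using x by (simp add: s_def pos_less_divide_eq)
    qed
    finally show "norm (resolvent A x - resolvent A w) < r" by (simp add: R'_eq)
  qed
qed

text \<open>A maximum principle for the distance of the resolvent to a complex subspace \<open>M\<close> of
  operators. With \<open>M = {0}\<close> it bounds the resolvent itself, with \<open>M\<close> the finite-rank
  operators its image in the Calkin algebra. The factor 2 comes from complexifying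
  the norming functional crudely.\<close>

lemma resolvent_maximum_principle:
  fixes A :: "'a::cbanach \<Rightarrow>\<^sub>L 'a"
  assumes A: "clinear_op A" and V: "open V" "bounded V" and res: "closure V \<inter> spectrum_op A = {}"
    and M: "subspace M" "\<And>F. F \<in> M \<Longrightarrow> scal_op \<i> o\<^sub>L F \<in> M"
    and bd: "\<And>w. w \<in> frontier V \<Longrightarrow> infdist (resolvent A w) M \<le> C" and z: "z \<in> V"
  shows "infdist (resolvent A z) M \<le> 2 * C"
proof -
  obtain \<phi> where \<phi>: "linear \<phi>" "\<And>X. \<bar>\<phi> X\<bar> \<le> infdist X M" "\<phi> (resolvent A z) = infdist (resolvent A z) M"
    using Hahn_Banach_infdist[OF M(1)] by blast
  define \<psi> where "\<psi> = (\<lambda>X. Complex (\<phi> X) (- \<phi> (scal_op \<i> o\<^sub>L X)))"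
  note comp = bounded_bilinear.add_right[OF bounded_bilinear_blinfun_compose]
    bounded_bilinear.scaleR_right[OF bounded_bilinear_blinfun_compose]
  have add: "\<psi> (X + Y) = \<psi> X + \<psi> Y" for X Y
    by (simp add: \<psi>_def comp linear_add[OF \<phi>(1)] complex_eq_iff)
  have scaleR: "\<psi> (r *\<^sub>R X) = r *\<^sub>R \<psi> X" for r X
    by (simp add: \<psi>_def comp linear_cmul[OF \<phi>(1)] complex_eq_iff)
  have "scal_op \<i> o\<^sub>L (scal_op \<i> o\<^sub>L X) = - X" for X :: "'a \<Rightarrow>\<^sub>L 'a"
    by (rule blinfun_eqI) (simp add: blinfun.minus_left)
  then have imult: "\<psi> (scal_op \<i> o\<^sub>L X) = \<i> * \<psi> X" for X
    by (simp add: \<psi>_def linear_neg[OF \<phi>(1)] complex_eq_iff)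
  have cmult: "\<psi> (scal_op c o\<^sub>L X) = c * \<psi> X" for c X
  proof -
    have "scaleC c x = Re c *\<^sub>R x + Im c *\<^sub>R scaleC \<i> x" for x :: 'a
    proof -
      have "scaleC c x = scaleC (of_real (Re c) + of_real (Im c) * \<i>) x" by (simp add: complex_eq_iff)
      then show ?thesis by (simp only: scaleC_add_left scaleR_scaleC scaleC_scaleC)
    qed
    then have "scal_op c o\<^sub>L X = Re c *\<^sub>R X + Im c *\<^sub>R (scal_op \<i> o\<^sub>L X)"
      by (intro blinfun_eqI) (simp add: blinfun.add_left blinfun.scaleR_left)
    then have "\<psi> (scal_op c o\<^sub>L X) = Re c *\<^sub>R \<psi> X + Im c *\<^sub>R (\<i> * \<psi> X)" by (simp add: add scaleR imult)
    also have "\<dots> = c * \<psi> X" by (simp add: complex_eq_iff)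
    finally show ?thesis .
  qed
  have inf_i: "infdist (scal_op \<i> o\<^sub>L X) M \<le> infdist X M" for X
  proof -
    have "M \<noteq> {}" using subspace_0[OF M(1)] by blast
    then show ?thesis
      unfolding infdist_def[of X]
    proof (simp, intro cINF_greatest)
      fix F assume F: "F \<in> M"
      have "infdist (scal_op \<i> o\<^sub>L X) M \<le> dist (scal_op \<i> o\<^sub>L X) (scal_op \<i> o\<^sub>L F)"
        by (intro infdist_le M(2) F)
      also have "\<dots> = norm (scal_op \<i> o\<^sub>L (X - F))"
        by (simp add: dist_norm bounded_bilinear.diff_right[OF bounded_bilinear_blinfun_compose])
      also have "\<dots> \<le> norm (scal_op \<i> :: 'a \<Rightarrow>\<^sub>L 'a) * norm (X - F)" by (rule norm_blinfun_compose)
      also have "\<dots> \<le> 1 * norm (X - F)" using norm_scal_op_le[of \<i>] by (intro mult_right_mono) auto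
      finally show "infdist (scal_op \<i> o\<^sub>L X) M \<le> dist X F" by (simp add: dist_norm)
    qed
  qed
  have \<psi>le: "cmod (\<psi> X) \<le> 2 * infdist X M" for X
  proof -
    have "cmod (\<psi> X) \<le> \<bar>\<phi> X\<bar> + \<bar>\<phi> (scal_op \<i> o\<^sub>L X)\<bar>" using cmod_le[of "\<psi> X"] by (simp add: \<psi>_def)
    also have "\<dots> \<le> 2 * infdist X M" using \<phi>(2)[of X] \<phi>(2)[of "scal_op \<i> o\<^sub>L X"] inf_i[of X] by simp
    finally show ?thesis .
  qed
  have \<psi>bl: "bounded_linear \<psi>"
  proof (rule bounded_linear_intro[OF add scaleR])
    show "norm (\<psi> X) \<le> norm X * 2" for X
      using \<psi>le[of X] infdist_subspace_le_norm[OF M(1), of X] by simp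
  qed
  \<comment> \<open>By the resolvent identity the difference quotient equals
    \<open>\<psi> (resolvent A y o\<^sub>L resolvent A w)\<close>, so continuity of the resolvent
    gives the derivative.\<close>
  have deriv: "((\<lambda>w. \<psi> (resolvent A w)) has_field_derivative \<psi> (resolvent A w o\<^sub>L resolvent A w)) (at w)"
    if w: "w \<notin> spectrum_op A" for w
    unfolding has_field_derivative_iff
  proof (rule Lim_transform_eventually)
    have "((\<lambda>y. resolvent A y o\<^sub>L resolvent A w) \<longlongrightarrow> resolvent A w o\<^sub>L resolvent A w) (at w)"
      using isCont_resolvent[OF A w] unfolding isCont_def
      by (intro bounded_bilinear.tendsto[OF bounded_bilinear_blinfun_compose] tendsto_const)
    then show "((\<lambda>y. \<psi> (resolvent A y o\<^sub>L resolvent A w)) \<longlongrightarrow> \<psi> (resolvent A w o\<^sub>L resolvent A w)) (at w)"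
      by (rule bounded_linear.tendsto[OF \<psi>bl])
    have "eventually (\<lambda>y. y \<in> - spectrum_op A) (at w)"
      using w by (intro eventually_at_in_open' open_resolvent_set[OF A]) simp
    moreover have "eventually (\<lambda>y. y \<noteq> w) (at w)" by (simp add: eventually_at_filter)
    ultimately show "eventually (\<lambda>y. \<psi> (resolvent A y o\<^sub>L resolvent A w) =
        (\<psi> (resolvent A y) - \<psi> (resolvent A w)) / (y - w)) (at w)"
    proof eventually_elim
      case (elim y)
      have "\<psi> (resolvent A y) - \<psi> (resolvent A w) = \<psi> (resolvent A y - resolvent A w)"
        by (rule linear_diff[OF bounded_linear.linear[OF \<psi>bl], symmetric])
      also have "\<dots> = (y - w) * \<psi> (resolvent A y o\<^sub>L resolvent A w)"
        using resolvent_identity[OF resolvent[OF A w] resolvent[OF A, of y]] elim(1) by (simp add: cmult)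
      finally show ?case using elim(2) by simp
    qed
  qed
  have "cmod (\<psi> (resolvent A z)) \<le> 2 * C"
  proof (rule maximum_modulus_frontier[of "\<lambda>w. \<psi> (resolvent A w)" V])
    have out: "w \<notin> spectrum_op A" if "w \<in> closure V" for w using res that by blast
    show "(\<lambda>w. \<psi> (resolvent A w)) holomorphic_on interior V"
      unfolding holomorphic_on_def field_differentiable_def
    proof
      fix w assume "w \<in> interior V"
      then have "w \<in> closure V" using interior_subset closure_subset by blast
      from has_field_derivative_at_within[OF deriv[OF out[OF this]]]
      show "\<exists>f'. ((\<lambda>w. \<psi> (resolvent A w)) has_field_derivative f') (at w within interior V)" by (rule exI)
    qed
    show "continuous_on (closure V) (\<lambda>w. \<psi> (resolvent A w))"
      using DERIV_isCont[OF deriv[OF out]] by (intro continuous_at_imp_continuous_on ballI)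
    fix w assume "w \<in> frontier V"
    from bd[OF this] \<psi>le[of "resolvent A w"] show "cmod (\<psi> (resolvent A w)) \<le> 2 * C" by simp
  qed (use V z in auto)
  moreover have "Re (\<psi> (resolvent A z)) = infdist (resolvent A z) M" by (simp add: \<psi>_def \<phi>(3))
  ultimately show ?thesis using complex_Re_le_cmod[of "\<psi> (resolvent A z)"] by simp
qed

text \<open>Local constants and thresholds are merged by maxima over a finite subcover;
  \<open>mono\<close> permits the larger constant.\<close>

lemma compact_uniform_bound:
  fixes P :: "nat \<Rightarrow> 'c::metric_space \<Rightarrow> real \<Rightarrow> bool"
  assumes K: "compact K" and mono: "\<And>n w C C'. P n w C \<Longrightarrow> C \<le> C' \<Longrightarrow> P n w C'"
    and loc: "\<And>l. l \<in> K \<Longrightarrow> \<exists>d>0. \<exists>C N. \<forall>n\<ge>N. \<forall>w\<in>ball l d. P n w C"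
  obtains C N where "\<And>n w. N \<le> n \<Longrightarrow> w \<in> K \<Longrightarrow> P n w C"
proof -
  obtain d C N where d: "\<And>l. l \<in> K \<Longrightarrow> d l > 0"
    and P: "\<And>l n w. l \<in> K \<Longrightarrow> N l \<le> n \<Longrightarrow> w \<in> ball l (d l) \<Longrightarrow> P n w (C l)"
    using loc by metis
  have "K \<subseteq> (\<Union>l\<in>K. ball l (d l))" using d by auto
  from compactE_image[OF K _ this] obtain L where L: "L \<subseteq> K" "finite L" "K \<subseteq> (\<Union>l\<in>L. ball l (d l))"
    by auto
  have "P n w (Max (C ` L))" if n: "Max (N ` L) \<le> n" and w: "w \<in> K" for n w
  proof -
    obtain l where l: "l \<in> L" "w \<in> ball l (d l)" using w L(3) by blast
    have "N l \<le> Max (N ` L)" using l(1) L(2) by simp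
    then have "P n w (C l)" using P[of l n w] l L(1) n by auto
    moreover have "C l \<le> Max (C ` L)" using l(1) L(2) by simp
    ultimately show ?thesis by (rule mono)
  qed
  then show thesis by (rule that)
qed

subsection \<open>Consequences of \<open>\<nu>\<close>-convergence\<close>

locale nu_approximation =
  fixes T :: "'a::cbanach \<Rightarrow>\<^sub>L 'a" and Tn :: "nat \<Rightarrow> 'a \<Rightarrow>\<^sub>L 'a"
  assumes T: "clinear_op T" and Tn: "\<And>n. clinear_op (Tn n)" and nu: "nu_conv Tn T"
begin

lemma error_T_tendsto: "(\<lambda>n. norm ((Tn n - T) o\<^sub>L T)) \<longlonglongrightarrow> 0"
  and error_Tn_tendsto: "(\<lambda>n. norm ((Tn n - T) o\<^sub>L Tn n)) \<longlonglongrightarrow> 0"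
  using nu by (auto simp: nu_conv_def)

lemma norm_bound:
  obtains K where "0 < K" "\<And>n. norm (Tn n) \<le> K"
proof -
  from nu obtain K where K: "0 < K" "\<And>x. x \<in> range (\<lambda>n. norm (Tn n)) \<Longrightarrow> norm x \<le> K"
    unfolding nu_conv_def bounded_pos by blast
  then have "norm (Tn n) \<le> K" for n using K(2)[of "norm (Tn n)"] by simp
  with K(1) show thesis by (rule that)
qed

lemma error_bound:
  obtains K where "0 < K" "\<And>n. norm (Tn n - T) \<le> K"
proof -
  obtain K where K: "0 < K" "\<And>n. norm (Tn n) \<le> K" using norm_bound by blast
  show thesis
  proof (rule that[of "K + norm T"])
    show "0 < K + norm T" using K(1) by (simp add: add_pos_nonneg)
    show "norm (Tn n - T) \<le> K + norm T" for n
      using norm_triangle_ineq4[of "Tn n" T] K(2)[of n] by linarith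
  qed
qed

lemma error_clinear: "clinear_op (Tn n - T)"
  by (intro clinear_op_diff T Tn)

text \<open>The error \<open>E = Tn n - T\<close> need not be small, but \<open>E R E\<close> is, because
  \<open>\<lambda> R = T R - id\<close> and both \<open>E T\<close> and \<open>E E\<close> are small.\<close>

lemma error_resolvent_error_tendsto:
  assumes l: "l \<noteq> 0" and R: "inverse_ops (T - scal_op l) R"
  shows "(\<lambda>n. norm ((Tn n - T) o\<^sub>L (R o\<^sub>L (Tn n - T)))) \<longlonglongrightarrow> 0"
proof -
  obtain K where K: "0 < K" "\<And>n. norm (Tn n - T) \<le> K" using error_bound by blast
  let ?a = "\<lambda>n. norm ((Tn n - T) o\<^sub>L T)" and ?b = "\<lambda>n. norm ((Tn n - T) o\<^sub>L Tn n)"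
  let ?u = "\<lambda>n. (?a n * (norm R * K) + (?b n + ?a n)) / cmod l"
  have le: "norm ((Tn n - T) o\<^sub>L (R o\<^sub>L (Tn n - T))) \<le> ?u n" for n
  proof -
    define E where "E = Tn n - T"
    have lR: "scaleC l (R y) = T (R y) - y" for y
    proof -
      have "T (R y) - scaleC l (R y) = y" using inverse_ops_apply(1)[OF R, of y] by (simp add: blinfun.diff_left)
      then show ?thesis by (metis add_diff_cancel_left' diff_add_cancel)
    qed
    have Ec: "clinear_op E" unfolding E_def by (rule error_clinear)
    \<comment> \<open>The square of \<open>E\<close> is split so that each term contains a factor
      that tends to 0 by \<nu>-convergence.\<close>
    have eq: "scal_op l o\<^sub>L (E o\<^sub>L (R o\<^sub>L E)) = ((E o\<^sub>L T) o\<^sub>L (R o\<^sub>L E)) - ((E o\<^sub>L Tn n) - (E o\<^sub>L T))"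
    proof (rule blinfun_eqI)
      fix x
      have "scaleC l (E (R (E x))) = E (T (R (E x))) - E (E x)"
        by (metis lR clinear_op_scaleC[OF Ec] blinfun.diff_right)
      moreover have "E (E x) = E (Tn n x) - E (T x)" by (simp add: E_def blinfun.diff_left blinfun.diff_right)
      ultimately show "(scal_op l o\<^sub>L (E o\<^sub>L (R o\<^sub>L E))) x
          = (((E o\<^sub>L T) o\<^sub>L (R o\<^sub>L E)) - ((E o\<^sub>L Tn n) - (E o\<^sub>L T))) x"
        by (simp add: blinfun.diff_left)
    qed
    have "norm ((E o\<^sub>L T) o\<^sub>L (R o\<^sub>L E)) \<le> ?a n * (norm R * K)"
    proof -
      have "norm (R o\<^sub>L E) \<le> norm R * K"
        using norm_blinfun_compose[of R E] mult_left_mono[OF K(2)[of n] norm_ge_zero[of R]] by (simp add: E_def)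
      then show ?thesis
        using norm_blinfun_compose[of "E o\<^sub>L T" "R o\<^sub>L E"] mult_left_mono[of "norm (R o\<^sub>L E)" "norm R * K" "?a n"]
        by (simp add: E_def)
    qed
    moreover have "norm ((E o\<^sub>L Tn n) - (E o\<^sub>L T)) \<le> ?b n + ?a n" unfolding E_def by (rule norm_triangle_ineq4)
    ultimately have num: "norm (scal_op l o\<^sub>L (E o\<^sub>L (R o\<^sub>L E))) \<le> ?a n * (norm R * K) + (?b n + ?a n)"
      unfolding eq by (meson add_mono norm_triangle_ineq4 order_trans)
    have "norm (E o\<^sub>L (R o\<^sub>L E)) \<le> norm (scal_op l o\<^sub>L (E o\<^sub>L (R o\<^sub>L E))) / cmod l"
    proof (rule norm_blinfun_bound)
      fix x
      have "cmod l * norm ((E o\<^sub>L (R o\<^sub>L E)) x) = norm ((scal_op l o\<^sub>L (E o\<^sub>L (R o\<^sub>L E))) x)"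
        by (simp add: norm_scaleC)
      also have "\<dots> \<le> norm (scal_op l o\<^sub>L (E o\<^sub>L (R o\<^sub>L E))) * norm x" by (rule norm_blinfun)
      finally show "norm ((E o\<^sub>L (R o\<^sub>L E)) x) \<le> norm (scal_op l o\<^sub>L (E o\<^sub>L (R o\<^sub>L E))) / cmod l * norm x"
        using l by (simp add: field_simps)
    qed simp
    also have "\<dots> \<le> ?u n" using num by (rule divide_right_mono) simp
    finally show ?thesis by (simp add: E_def)
  qed
  have "?u \<longlonglongrightarrow> (0 * (norm R * K) + (0 + 0)) / cmod l"
    by (intro tendsto_intros error_T_tendsto error_Tn_tendsto) (use l in simp)
  then have "?u \<longlonglongrightarrow> 0" by simp
  then show ?thesis by (rule Lim_null_comparison[rotated]) (simp add: le)
qed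

text \<open>Here \<open>Tn n - scal_op w\<close> is \<open>T - scal_op l\<close> plus a perturbation
  \<open>D\<close> that need not be small, but \<open>Q\<close>, the square of \<open>D R\<close>,
  is. Since \<open>id + D R\<close> and \<open>id - D R\<close> multiply to \<open>id - Q\<close> in
  either order, inverting \<open>id - Q\<close> inverts the operator with a uniform bound.\<close>

lemma resolvent_locally_bounded:
  assumes l: "l \<noteq> 0" and R: "inverse_ops (T - scal_op l) R"
  shows "\<exists>d>0. \<exists>C N. \<forall>n\<ge>N. \<forall>w\<in>ball l d. \<exists>B. inverse_ops (Tn n - scal_op w) B \<and> norm B \<le> C"
proof -
  obtain K where K: "0 < K" "\<And>n. norm (Tn n - T) \<le> K" using error_bound by blast
  define r where "r = norm R"
  have r: "0 \<le> r" by (simp add: r_def)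
  \<comment> \<open>Chosen so that the shift from \<open>l\<close> to \<open>w\<close> contributes
    at most \<open>1/4\<close> to the bound \<open>1/2\<close> for \<open>Q\<close>; the other
    \<open>1/4\<close> comes from the threshold \<open>1 / (4 * (r + 1))\<close> below.\<close>
  define d where "d = min 1 (1 / (4 * (2 * K + 1) * (r * r + 1)))"
  have den: "0 < 4 * (2 * K + 1) * (r * r + 1)" using K(1) by (intro mult_pos_pos add_nonneg_pos) auto
  then have d: "0 < d" "d \<le> 1" by (auto simp: d_def)
  have "d * (2 * K + 1) * (r * r) \<le> 1/4"
  proof -
    have "d * (4 * (2 * K + 1) * (r * r + 1)) \<le> 1"
      unfolding pos_le_divide_eq[OF den, symmetric] d_def by (rule min.cobounded2)
    moreover have "d * (4 * (2 * K + 1) * (r * r + 1)) = 4 * (d * (2 * K + 1) * (r * r)) + 4 * (d * (2 * K + 1))"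
      by (simp add: algebra_simps)
    moreover have "0 \<le> d * (2 * K + 1)" using d K(1) by simp
    ultimately show ?thesis by linarith
  qed
  note dr = this
  have "eventually (\<lambda>n. norm ((Tn n - T) o\<^sub>L (R o\<^sub>L (Tn n - T))) < 1 / (4 * (r + 1))) sequentially"
    using order_tendstoD(2)[OF error_resolvent_error_tendsto[OF l R], of "1 / (4 * (r + 1))"] r by simp
  then obtain N where N: "\<And>n. N \<le> n \<Longrightarrow> norm ((Tn n - T) o\<^sub>L (R o\<^sub>L (Tn n - T))) < 1 / (4 * (r + 1))"
    by (auto simp: eventually_sequentially)
  have "\<exists>B. inverse_ops (Tn n - scal_op w) B \<and> norm B \<le> r * ((1 + (K + 1) * r) * 2)"
    if n: "N \<le> n" and w: "w \<in> ball l d" for n w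
  proof -
    define E where "E = Tn n - T"
    define s :: "'a \<Rightarrow>\<^sub>L 'a" where "s = scal_op (w - l)"
    define D where "D = E - s"
    have EK: "norm E \<le> K" by (simp add: E_def K(2))
    have sd: "norm s \<le> d"
      using norm_scal_op_le[where 'a = 'a and c = "w - l"] w by (simp add: s_def dist_norm norm_minus_commute)
    have DK: "norm D \<le> K + 1" using norm_triangle_ineq4[of E s] EK sd d(2) by (simp add: D_def)
    have Dc: "clinear_op D" unfolding D_def E_def s_def by (intro clinear_op_intros T Tn)
    note Rc = inverse_ops_clinear(2)[OF R]
    have expand: "D o\<^sub>L (R o\<^sub>L D) = (E o\<^sub>L (R o\<^sub>L E)) - (E o\<^sub>L (R o\<^sub>L s)) - (s o\<^sub>L (R o\<^sub>L D))"
      by (rule blinfun_eqI) (simp add: D_def blinfun.diff_left blinfun.diff_right)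
    have n1: "norm (E o\<^sub>L (R o\<^sub>L s)) \<le> K * (r * d)"
      unfolding r_def
      by (intro order_trans[OF norm_blinfun_compose] mult_mono EK order_trans[OF norm_blinfun_compose] sd)
        (use K(1) in auto)
    have n2: "norm (s o\<^sub>L (R o\<^sub>L D)) \<le> d * (r * (K + 1))"
      unfolding r_def
      by (intro order_trans[OF norm_blinfun_compose] mult_mono DK order_trans[OF norm_blinfun_compose] sd)
        (use K(1) d in auto)
    have n0: "norm (E o\<^sub>L (R o\<^sub>L E)) * r \<le> 1/4"
    proof -
      have "norm (E o\<^sub>L (R o\<^sub>L E)) * r \<le> 1 / (4 * (r + 1)) * r"
        using N[OF n] r by (intro mult_right_mono) (auto simp: E_def)
      also have "\<dots> \<le> 1/4" using r by (simp add: field_simps)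
      finally show ?thesis .
    qed
    have "norm (D o\<^sub>L (R o\<^sub>L D)) \<le> norm (E o\<^sub>L (R o\<^sub>L E)) + K * (r * d) + d * (r * (K + 1))"
      using norm_triangle_ineq4[of "(E o\<^sub>L (R o\<^sub>L E)) - (E o\<^sub>L (R o\<^sub>L s))" "s o\<^sub>L (R o\<^sub>L D)"]
        norm_triangle_ineq4[of "E o\<^sub>L (R o\<^sub>L E)" "E o\<^sub>L (R o\<^sub>L s)"] n1 n2 unfolding expand by linarith
    then have "norm (D o\<^sub>L (R o\<^sub>L D)) * r \<le> (norm (E o\<^sub>L (R o\<^sub>L E)) + K * (r * d) + d * (r * (K + 1))) * r"
      using r by (rule mult_right_mono)
    also have "\<dots> = norm (E o\<^sub>L (R o\<^sub>L E)) * r + d * (2 * K + 1) * (r * r)" by (simp add: algebra_simps)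
    also have "\<dots> \<le> 1/2" using n0 dr by linarith
    finally have half: "norm ((D o\<^sub>L (R o\<^sub>L D)) o\<^sub>L R) \<le> 1/2"
      using norm_blinfun_compose[of "D o\<^sub>L (R o\<^sub>L D)" R] by (simp add: r_def)
    define Q where "Q = (D o\<^sub>L (R o\<^sub>L D)) o\<^sub>L R"
    have Qc: "clinear_op Q" unfolding Q_def by (intro clinear_op_compose Dc Rc)
    have idle: "norm (id_blinfun :: 'a \<Rightarrow>\<^sub>L 'a) \<le> 1" by (rule norm_blinfun_id_le)
    have "inverse_ops id_blinfun (id_blinfun :: 'a \<Rightarrow>\<^sub>L 'a)" by (rule inverse_opsI) (simp_all add: clinear_op_id)
    moreover have "norm (- Q) * norm (id_blinfun :: 'a \<Rightarrow>\<^sub>L 'a) \<le> 1/2"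
      using mult_mono[OF half idle] by (simp add: Q_def)
    ultimately obtain U where U: "inverse_ops (id_blinfun + - Q) U" "norm U \<le> 2 * norm (id_blinfun :: 'a \<Rightarrow>\<^sub>L 'a)"
      using inverse_ops_perturb[OF _ clinear_op_minus[OF Qc]] by metis
    have Uc: "clinear_op U" by (rule inverse_ops_clinear(2)[OF U(1)])
    define G where "G = id_blinfun - (D o\<^sub>L R)"
    have Gc: "clinear_op G" unfolding G_def by (intro clinear_op_diff clinear_op_id clinear_op_compose Dc Rc)
    have Gx: "G x = x - D (R x)" for x by (simp add: G_def blinfun.diff_left)
    have QU: "U x - Q (U x) = x" "U (x - Q x) = x" for x
      using inverse_ops_apply[OF U(1), of x] by (simp_all add: blinfun.diff_left)
    define A where "A = Tn n - scal_op w"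
    have Ac: "clinear_op A" unfolding A_def by (intro clinear_op_diff Tn clinear_op_scal)
    have A_eq: "A = (T - scal_op l) + D" by (simp add: A_def D_def E_def s_def scal_op_diff)
    have AR: "A (R x) = x + D (R x)" for x by (simp add: A_eq blinfun.add_left inverse_ops_apply(1)[OF R])
    have GA: "G x + D (R (G x)) = x - Q x" for x by (simp add: Gx Q_def blinfun.diff_right)
    have AG: "G (x + D (R x)) = x - Q x" for x by (simp add: Gx Q_def blinfun.add_right)
    \<comment> \<open>The right inverse is \<open>R G U\<close> and the left inverse is
      \<open>R U G\<close>; having both, they agree, so \<open>U\<close> and \<open>G\<close> need
      not be shown to commute.\<close>
    have "inverse_ops A (R o\<^sub>L (G o\<^sub>L U))"
    proof (rule inverse_ops_left_right[OF Ac, where B' = "R o\<^sub>L (U o\<^sub>L G)"])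
      show "clinear_op (R o\<^sub>L (G o\<^sub>L U))" by (intro clinear_op_compose Rc Gc Uc)
      show "A ((R o\<^sub>L (G o\<^sub>L U)) x) = x" for x by (simp add: AR GA QU)
      show "(R o\<^sub>L (U o\<^sub>L G)) (A x) = x" for x
      proof -
        define y where "y = (T - scal_op l) x"
        have x: "x = R y" by (simp only: y_def inverse_ops_apply(2)[OF R])
        show ?thesis by (simp add: x AR AG QU)
      qed
    qed
    moreover have "norm (R o\<^sub>L (G o\<^sub>L U)) \<le> r * ((1 + (K + 1) * r) * 2)"
    proof -
      have "norm (D o\<^sub>L R) \<le> (K + 1) * r"
        unfolding r_def by (intro order_trans[OF norm_blinfun_compose] mult_right_mono DK) simp
      then have "norm G \<le> 1 + (K + 1) * r" unfolding G_def using norm_triangle_ineq4[of id_blinfun "D o\<^sub>L R"] idle by linarith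
      moreover have "norm U \<le> 2" using U(2) idle by linarith
      ultimately show ?thesis
        unfolding r_def using K(1)
        by (intro order_trans[OF norm_blinfun_compose] mult_mono order_refl) (auto simp: r_def)
    qed
    ultimately show ?thesis unfolding A_def by blast
  qed
  then show ?thesis using d(1) by blast
qed

text \<open>This gives upper semicontinuity of the spectrum, and also the bounds on small circles
  for the maximum principle.\<close>

lemma resolvent_uniformly_bounded:
  assumes K: "compact K" "0 \<notin> K" "K \<inter> spectrum_op T = {}"
  obtains C N where "\<And>n w. N \<le> n \<Longrightarrow> w \<in> K \<Longrightarrow> w \<notin> spectrum_op (Tn n) \<and> norm (resolvent (Tn n) w) \<le> C"
proof -
  obtain C N where CN: "\<And>n w. N \<le> n \<Longrightarrow> w \<in> K \<Longrightarrow> \<exists>B. inverse_ops (Tn n - scal_op w) B \<and> norm B \<le> C"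
  proof (rule compact_uniform_bound[OF K(1), where P = "\<lambda>n w C. \<exists>B. inverse_ops (Tn n - scal_op w) B \<and> norm B \<le> C"])
    show "\<exists>B. inverse_ops (Tn n - scal_op w) B \<and> norm B \<le> C'"
      if "\<exists>B. inverse_ops (Tn n - scal_op w) B \<and> norm B \<le> C" "C \<le> C'" for n w C C'
      using that order_trans by blast
    show "\<exists>d>0. \<exists>C N. \<forall>n\<ge>N. \<forall>w\<in>ball l d. \<exists>B. inverse_ops (Tn n - scal_op w) B \<and> norm B \<le> C"
      if "l \<in> K" for l
    proof -
      have "l \<notin> spectrum_op T" "l \<noteq> 0" using that K by auto
      then show ?thesis using resolvent_locally_bounded resolvent[OF T] by blast
    qed
  qed blast
  show thesis
  proof (rule that)
    fix n w assume "N \<le> n" "w \<in> K"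
    then obtain B where B: "inverse_ops (Tn n - scal_op w) B" "norm B \<le> C" using CN by blast
    then have "w \<notin> spectrum_op (Tn n)" using notin_spectrum_iff[OF Tn] by blast
    moreover from this have "B = resolvent (Tn n) w" using inverse_ops_unique[OF B(1)] resolvent[OF Tn] by blast
    ultimately show "w \<notin> spectrum_op (Tn n) \<and> norm (resolvent (Tn n) w) \<le> C" using B(2) by simp
  qed
qed

text \<open>For an eigenvector \<open>x\<close>, \<open>(Tn n - scal_op z) x\<close> is the error
  applied to \<open>x\<close>; it tends to 0, because \<open>z\<close> times it is the error applied
  to \<open>T x\<close>. So the resolvents at \<open>z\<close> cannot stay bounded, whereas in a gap
  the maximum principle would bound them by their values on a small circle.\<close>

lemma isolated_eigenvalue_persists:
  assumes z: "z \<noteq> 0" "\<not> z islimpt spectrum_op T" and x: "x \<noteq> 0" "T x = scaleC z x" and e: "0 < e"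
  shows "\<exists>n. spectrum_op (Tn n) \<inter> ball z e \<noteq> {}"
proof (rule ccontr)
  assume "\<not> ?thesis"
  then have gap: "spectrum_op (Tn n) \<inter> ball z e = {}" for n by blast
  obtain r0 where r0: "0 < r0" "\<And>y. y \<in> spectrum_op T \<Longrightarrow> y \<noteq> z \<Longrightarrow> r0 \<le> dist y z"
    using z(2) unfolding islimpt_approachable by (meson not_le)
  \<comment> \<open>The three bounds make the circle avoid \<open>spectrum_op T\<close>, put the
    closed disc in the gap, and make the circle avoid 0.\<close>
  define r where "r = min (r0 / 2) (min (e / 2) (cmod z / 2))"
  have r: "0 < r" "r < r0" "r < e" "r < cmod z" using r0(1) e z(1) by (auto simp: r_def min_less_iff_disj)
  have "sphere z r \<inter> spectrum_op T = {}"
  proof (rule ccontr)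
    assume "sphere z r \<inter> spectrum_op T \<noteq> {}"
    then obtain y where "y \<in> sphere z r" and y2: "y \<in> spectrum_op T" by blast
    then have y: "dist z y = r" by simp
    then have "y \<noteq> z" using r(1) by auto
    from r0(2)[OF y2 this] show False using y r(2) by (simp add: dist_commute)
  qed
  moreover have "0 \<notin> sphere z r" using r(4) by simp
  ultimately obtain C N where CN: "\<And>n w. N \<le> n \<Longrightarrow> w \<in> sphere z r \<Longrightarrow> norm (resolvent (Tn n) w) \<le> C"
    using resolvent_uniformly_bounded[of "sphere z r"] by (metis compact_sphere)
  have bound: "1 \<le> 2 * C * (norm ((Tn n - T) o\<^sub>L T) / cmod z)" if n: "N \<le> n" for n
  proof -
    have cl: "closure (ball z r) \<inter> spectrum_op (Tn n) = {}"
      using gap[of n] r(1,3) by (auto simp: disjoint_iff)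
    have "infdist (resolvent (Tn n) z) {0} \<le> 2 * C"
    proof (rule resolvent_maximum_principle[OF Tn _ _ cl])
      show "infdist (resolvent (Tn n) w) {0} \<le> C" if "w \<in> frontier (ball z r)" for w
        using CN[OF n, of w] that r(1) by simp
    qed (use r(1) in auto)
    then have R: "norm (resolvent (Tn n) z) \<le> 2 * C" by simp
    have "z \<notin> spectrum_op (Tn n)" using gap[of n] e by auto
    note inv = resolvent[OF Tn this]
    have "(Tn n - scal_op z) x = (Tn n - T) x" by (simp add: blinfun.diff_left x(2))
    then have "x = resolvent (Tn n) z ((Tn n - T) x)" using inverse_ops_apply(2)[OF inv, of x] by simp
    then have 1: "norm x \<le> norm (resolvent (Tn n) z) * norm ((Tn n - T) x)" by (metis norm_blinfun)
    have "((Tn n - T) o\<^sub>L T) x = scaleC z ((Tn n - T) x)"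
      by (simp add: x(2) clinear_op_scaleC[OF error_clinear])
    then have "cmod z * norm ((Tn n - T) x) \<le> norm ((Tn n - T) o\<^sub>L T) * norm x"
      by (metis norm_blinfun norm_scaleC)
    then have "norm ((Tn n - T) x) \<le> norm ((Tn n - T) o\<^sub>L T) / cmod z * norm x"
      using z(1) by (simp add: field_simps)
    then have "norm (resolvent (Tn n) z) * norm ((Tn n - T) x) \<le> 2 * C * (norm ((Tn n - T) o\<^sub>L T) / cmod z * norm x)"
      using R order_trans[OF norm_ge_zero R] by (intro mult_mono) auto
    with 1 have "1 * norm x \<le> (2 * C * (norm ((Tn n - T) o\<^sub>L T) / cmod z)) * norm x" by simp
    then show ?thesis by (rule mult_right_le_imp_le) (simp add: x(1))
  qed
  have "(\<lambda>n. 2 * C * (norm ((Tn n - T) o\<^sub>L T) / cmod z)) \<longlonglongrightarrow> 2 * C * (0 / cmod z)"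
    by (intro tendsto_intros error_T_tendsto) (use z(1) in simp)
  then have "1 \<le> 2 * C * (0 / cmod z)"
    by (rule LIMSEQ_le_const) (use bound in blast)
  then show False by simp
qed

end

text \<open>Passing to the subsequence of bad indices later turns statements about some
  \<open>n\<close> into statements about all large \<open>n\<close>.\<close>

lemma nu_approximation_subseq:
  assumes "nu_approximation T Tn" "strict_mono r"
  shows "nu_approximation T (\<lambda>n. Tn (r n))"
proof -
  interpret nu_approximation T Tn by fact
  have "bounded (range (\<lambda>n. norm (Tn (r n))))"
    using nu by (auto simp: nu_conv_def elim!: bounded_subset)
  moreover note LIMSEQ_subseq_LIMSEQ[OF error_T_tendsto assms(2)] LIMSEQ_subseq_LIMSEQ[OF error_Tn_tendsto assms(2)]
  ultimately show ?thesis by unfold_locales (simp_all add: T Tn nu_conv_def comp_def)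
qed

subsection \<open>Fredholm limits\<close>

lemma quotient_le_half: "0 \<le> x \<Longrightarrow> 1 / (2 * (x + 1)) * x \<le> (1/2 :: real)"
  by (simp add: field_simps)

locale fredholm_nu_approximation = nu_approximation +
  assumes fredholm: "fredholm (blinfun_apply T)"
begin

text \<open>The error is composed with \<open>P\<close>, which maps into the range of
  \<open>T\<close>, and with \<open>id_blinfun - P\<close>, of finite rank. The first part is small
  because \<open>P x = T u\<close> with \<open>norm u\<close> controlled by the open mapping
  theorem.\<close>

lemma error_decomposition:
  obtains S F where "\<And>n. clinear_op (S n)" "\<And>n. finite_rank (F n)" "\<And>n. Tn n = T + S n + F n"
    "(\<lambda>n. norm (S n)) \<longlonglongrightarrow> 0"
proof -
  have cl: "closed (range T)" using fredholm by (simp add: fredholm_def)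
  obtain k where "codim_sub (range T) = enat k" using fredholm by (auto simp: fredholm_def defect_def)
  then obtain B where "finite B" "cspan (range T \<union> B) = UNIV" using codim_sub_finite by metis
  from finite_codim_projection[OF this(1) cl csubspace_range[OF T] this(2)]
  obtain P where P: "clinear_op P" "range P \<subseteq> range T" "finite_rank (id_blinfun - P)" by blast
  obtain C where C: "0 \<le> C" "\<And>y. y \<in> range T \<Longrightarrow> \<exists>x. T x = y \<and> norm x \<le> C * norm y"
    using open_mapping_closed_range[OF cl] by blast
  define S where "S = (\<lambda>n. (Tn n - T) o\<^sub>L P)"
  define F where "F = (\<lambda>n. (Tn n - T) o\<^sub>L (id_blinfun - P))"
  have le: "norm (S n) \<le> norm ((Tn n - T) o\<^sub>L T) * (C * norm P)" for n
  proof (rule norm_blinfun_bound)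
    fix x
    obtain u where u: "T u = P x" "norm u \<le> C * norm (P x)" using C(2)[of "P x"] P(2) by blast
    have "norm (S n x) = norm (((Tn n - T) o\<^sub>L T) u)" by (simp add: S_def u(1))
    also have "\<dots> \<le> norm ((Tn n - T) o\<^sub>L T) * norm u" by (rule norm_blinfun)
    also have "\<dots> \<le> norm ((Tn n - T) o\<^sub>L T) * (C * (norm P * norm x))"
      using order_trans[OF u(2) mult_left_mono[OF norm_blinfun C(1)]] by (rule mult_left_mono) simp
    finally show "norm (S n x) \<le> norm ((Tn n - T) o\<^sub>L T) * (C * norm P) * norm x" by (simp add: mult.assoc)
  qed (use C(1) in simp)
  show thesis
  proof (rule that[of S F])
    show "clinear_op (S n)" for n unfolding S_def by (intro clinear_op_compose error_clinear P(1))
    show "finite_rank (F n)" for n unfolding F_def by (rule finite_rank_compose_left[OF P(3) error_clinear])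
    show "Tn n = T + S n + F n" for n
      by (rule blinfun_eqI) (simp add: S_def F_def blinfun.add_left blinfun.diff_left blinfun.diff_right)
    have "(\<lambda>n. norm ((Tn n - T) o\<^sub>L T) * (C * norm P)) \<longlonglongrightarrow> 0"
      by (rule tendsto_mult_left_zero[OF error_T_tendsto])
    then show "(\<lambda>n. norm (S n)) \<longlonglongrightarrow> 0"
      by (rule Lim_null_comparison[rotated]) (simp add: le)
  qed
qed

text \<open>Subtracting \<open>F n\<close> from the invertible \<open>Tn n - scal_op w\<close>
  leaves an index-zero operator at distance \<open>norm (S n)\<close> from
  \<open>T - scal_op w\<close>.\<close>

lemma index_zero_limit_of_invertible:
  assumes "\<And>n. w \<notin> spectrum_op (Tn n)"
  shows "index_zero_limit (T - scal_op w)"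
  unfolding index_zero_limit_def
proof (intro conjI allI impI)
  show "clinear_op (T - scal_op w)" by (intro clinear_op_diff T clinear_op_scal)
  fix e :: real assume e: "e > 0"
  obtain S F where SF: "\<And>n. clinear_op (S n)" "\<And>n. finite_rank (F n)" "\<And>n. Tn n = T + S n + F n"
    "(\<lambda>n. norm (S n)) \<longlonglongrightarrow> 0" using error_decomposition by blast
  obtain n where n: "norm (S n) < e"
    using order_tendstoD(2)[OF SF(4) e] by (auto simp: eventually_sequentially)
  have "index_zero ((Tn n - scal_op w) + - F n)"
    by (intro index_zero_add_finite_rank finite_rank_minus SF(2) index_zero_inverse_ops[OF resolvent[OF Tn assms]])
  moreover have "(T - scal_op w) - ((Tn n - scal_op w) + - F n) = - S n" by (simp add: SF(3))
  ultimately show "\<exists>G. index_zero G \<and> norm (T - scal_op w - G) < e"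
    using n by (metis norm_minus_cancel)
qed

text \<open>The maximum principle is applied to the distance of the resolvents of
  \<open>Tn n\<close> from the finite-rank operators. Near a frontier point this distance is bounded
  by the inverse of an invertible part of \<open>T - scal_op l\<close>. The bound inside then gives
  an approximate inverse modulo finite rank, good enough to absorb the small
  \<open>S n\<close>.\<close>

lemma index_zero_inside:
  assumes V: "open V" "bounded V" and res: "\<And>n. closure V \<inter> spectrum_op (Tn n) = {}"
    and fr: "\<And>w. w \<in> frontier V \<Longrightarrow> index_zero (T - scal_op w)" and z: "z \<in> V"
  shows "index_zero (T - scal_op z)"
proof -
  obtain S F where SF: "\<And>n. clinear_op (S n)" "\<And>n. finite_rank (F n)" "\<And>n. Tn n = T + S n + F n"
    "(\<lambda>n. norm (S n)) \<longlonglongrightarrow> 0" using error_decomposition by blast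
  let ?FR = "{F :: 'a \<Rightarrow>\<^sub>L 'a. finite_rank F}"
  \<comment> \<open>Quantifying over all inverses lets the local estimate hold also at points
    \<open>w\<close> where \<open>Tn n - scal_op w\<close> might not be invertible.\<close>
  let ?P = "\<lambda>n w C. \<forall>R. inverse_ops (Tn n - scal_op w) R \<longrightarrow> infdist R ?FR \<le> C"
  have "compact (frontier V)" using V(2) by (rule compact_frontier_bounded)
  then obtain C N where CN: "\<And>n w. N \<le> n \<Longrightarrow> w \<in> frontier V \<Longrightarrow> ?P n w C"
  proof (rule compact_uniform_bound[where P = ?P])
    show "?P n w C'" if "?P n w C" "C \<le> C'" for n w C C' using that order_trans by blast
    show "\<exists>d>0. \<exists>C N. \<forall>n\<ge>N. \<forall>w\<in>ball l d. ?P n w C" if l: "l \<in> frontier V" for l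
    proof -
      obtain W U G where WU: "inverse_ops W U" and G: "finite_rank G" and TW: "T - scal_op l = W + G"
        using fr[OF l] by (auto simp: index_zero_def)
      \<comment> \<open>One \<open>d\<close> is spent on \<open>S n\<close>, the other on the shift
        from \<open>l\<close> to \<open>w\<close>.\<close>
      define d where "d = (1 / (2 * (norm U + 1))) * (1/2)"
      have d: "0 < d" by (simp add: d_def add_nonneg_pos)
      have "2 * d = 1 / (2 * (norm U + 1))" unfolding d_def by (simp only: mult.commute[of _ "1/2"] mult.assoc[symmetric])
      then have dU: "2 * d * norm U \<le> 1/2" using quotient_le_half[OF norm_ge_zero[of U]] by (simp only:)
      obtain N where N: "\<And>n. N \<le> n \<Longrightarrow> norm (S n) < d"
        using order_tendstoD(2)[OF SF(4) d] by (auto simp: eventually_sequentially)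
      have "infdist R ?FR \<le> 2 * norm U"
        if n: "N \<le> n" and w: "w \<in> ball l d" and R: "inverse_ops (Tn n - scal_op w) R" for n w R
      proof -
        define D where "D = S n + scal_op (l - w)"
        have Dc: "clinear_op D" unfolding D_def by (intro clinear_op_add SF(1) clinear_op_scal)
        have "norm D \<le> 2 * d"
          using norm_triangle_ineq[of "S n" "scal_op (l - w)"] N[OF n] w
            norm_scal_op_le[where 'a = 'a and c = "l - w"] by (simp add: D_def dist_norm)
        then have "norm D * norm U \<le> 1/2" using mult_right_mono[of "norm D" "2 * d" "norm U"] dU by simp
        from inverse_ops_perturb[OF WU Dc this]
        obtain U' where U': "inverse_ops (W + D) U'" "norm U' \<le> 2 * norm U" .
        define H where "H = G + F n"
        have H: "finite_rank H" unfolding H_def by (rule finite_rank_add[OF G SF(2)])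
        have eq: "Tn n - scal_op w = (W + D) + H"
        proof -
          have "Tn n - scal_op w = (T - scal_op l) + scal_op (l - w) + S n + F n" by (simp add: SF(3) scal_op_diff)
          then show ?thesis by (simp add: TW D_def H_def)
        qed
        \<comment> \<open>The second resolvent identity: \<open>R\<close> agrees with
          \<open>U'\<close> up to a finite-rank operator.\<close>
        have "R = U' - (R o\<^sub>L (H o\<^sub>L U'))"
        proof (rule blinfun_eqI)
          fix x
          have "(Tn n - scal_op w) (U' x) = x + H (U' x)"
            unfolding eq blinfun.add_left[of "W + D" H] inverse_ops_apply(1)[OF U'(1)] ..
          then have "U' x = R x + R (H (U' x))"
            by (metis inverse_ops_apply(2)[OF R] blinfun.add_right)
          then have "R x = U' x - R (H (U' x))" by (simp only: eq_diff_eq)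
          then show "R x = (U' - (R o\<^sub>L (H o\<^sub>L U'))) x" by (simp add: blinfun.diff_left)
        qed
        moreover have fin: "finite_rank (- (R o\<^sub>L (H o\<^sub>L U')))"
          by (intro finite_rank_minus finite_rank_compose_left finite_rank_compose_right H
              inverse_ops_clinear(2)[OF U'(1)] inverse_ops_clinear(2)[OF R])
        ultimately have "dist R (- (R o\<^sub>L (H o\<^sub>L U'))) = norm U'"
          by (metis add_uminus_conv_diff add_diff_cancel_right' dist_norm)
        moreover have "infdist R ?FR \<le> dist R (- (R o\<^sub>L (H o\<^sub>L U')))" using fin by (intro infdist_le) simp
        ultimately show ?thesis using U'(2) by simp
      qed
      then show ?thesis using d by blast
    qed
  qed blast
  have "infdist (resolvent (Tn n) z) ?FR \<le> 2 * C" if n: "N \<le> n" for n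
  proof (rule resolvent_maximum_principle[OF Tn V res subspace_finite_rank])
    show "scal_op \<i> o\<^sub>L F \<in> ?FR" if "F \<in> ?FR" for F
      using that by (simp add: finite_rank_compose_left clinear_op_scal)
    fix w assume w: "w \<in> frontier V"
    then have "w \<notin> spectrum_op (Tn n)" using res[of n] by (auto simp: frontier_def)
    then show "infdist (resolvent (Tn n) w) ?FR \<le> C" using CN[OF n w] resolvent[OF Tn] by blast
  qed (rule z)
  note essbound = this
  have C: "0 \<le> C" using essbound[OF order_refl] infdist_nonneg[of "resolvent (Tn N) z" ?FR] by linarith
  have "eventually (\<lambda>n. norm (S n) < 1 / (2 * (2 * C + 1))) sequentially"
    using order_tendstoD(2)[OF SF(4)] C by simp
  then obtain n where n: "N \<le> n" "norm (S n) < 1 / (2 * (2 * C + 1))"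
    unfolding eventually_sequentially by (meson nle_le)
  define R where "R = resolvent (Tn n) z"
  have "z \<notin> spectrum_op (Tn n)" using res[of n] z closure_subset by blast
  then have R: "inverse_ops (Tn n - scal_op z) R" unfolding R_def by (rule resolvent[OF Tn])
  have "infdist R ?FR < 2 * C + 1" using essbound[OF n(1)] by (simp add: R_def)
  moreover have ne: "?FR \<noteq> {}" using finite_rank_zero by blast
  ultimately have "(INF G\<in>?FR. dist R G) < 2 * C + 1" by (simp only: infdist_def if_False)
  then have "\<exists>d\<in>dist R ` ?FR. d < 2 * C + 1" using cInf_lessD[of "dist R ` ?FR" "2 * C + 1"] ne by blast
  then obtain G where G: "finite_rank G" "norm (R - G) < 2 * C + 1" by (auto simp: dist_norm)
  define Y where "Y = R - G"
  have Yc: "clinear_op Y"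
    unfolding Y_def by (intro clinear_op_diff inverse_ops_clinear(2)[OF R] finite_rank_clinear G(1))
  have "norm (Y o\<^sub>L S n) \<le> norm Y * norm (S n)" by (rule norm_blinfun_compose)
  also have "\<dots> \<le> (2 * C + 1) * (1 / (2 * (2 * C + 1)))" using G(2) n(2) C by (intro mult_mono) (auto simp: Y_def)
  also have "\<dots> = 1/2" using C by (simp add: field_simps)
  finally have small: "norm (Y o\<^sub>L S n) \<le> 1/2" .
  have "inverse_ops id_blinfun (id_blinfun :: 'a \<Rightarrow>\<^sub>L 'a)" by (rule inverse_opsI) (simp_all add: clinear_op_id)
  moreover have "clinear_op (- (Y o\<^sub>L S n))" by (intro clinear_op_minus clinear_op_compose Yc SF(1))
  moreover have "norm (- (Y o\<^sub>L S n)) * norm (id_blinfun :: 'a \<Rightarrow>\<^sub>L 'a) \<le> 1/2"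
    using mult_mono[OF small norm_blinfun_id_le[where 'a = 'a]] by simp
  ultimately obtain U' where U': "inverse_ops (id_blinfun + - (Y o\<^sub>L S n)) U'"
    using inverse_ops_perturb by metis
  \<comment> \<open>Because \<open>Y = R - G\<close>, expanding \<open>W\<close> gives
    \<open>Tn n - scal_op z\<close> minus \<open>S n\<close> plus a finite-rank term containing
    \<open>G\<close>. Removing that term and \<open>F n\<close> leaves
    \<open>T - scal_op z\<close>.\<close>
  define W where "W = (Tn n - scal_op z) o\<^sub>L (id_blinfun + - (Y o\<^sub>L S n))"
  have W: "inverse_ops W (U' o\<^sub>L R)" unfolding W_def by (rule inverse_ops_compose[OF R U'])
  define H where "H = - ((Tn n - scal_op z) o\<^sub>L (G o\<^sub>L S n)) - F n"
  have "finite_rank H"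
    unfolding H_def
    by (intro finite_rank_diff finite_rank_minus finite_rank_compose_left finite_rank_compose_right G(1) SF(1,2)
        inverse_ops_clinear(1)[OF R])
  moreover have "T - scal_op z = W + H"
  proof (rule blinfun_eqI)
    fix x
    have "(Tn n - scal_op z) (R (S n x)) = S n x" by (rule inverse_ops_apply(1)[OF R])
    moreover have "(id_blinfun + - (Y o\<^sub>L S n)) x = x - (R (S n x) - G (S n x))"
      by (simp add: Y_def blinfun.diff_left)
    then have "W x = (Tn n - scal_op z) (x - (R (S n x) - G (S n x)))"
      by (simp only: W_def blinfun_apply_blinfun_compose)
    ultimately have "W x = (Tn n - scal_op z) x - (S n x - (Tn n - scal_op z) (G (S n x)))"
      by (simp only: blinfun.diff_right)
    moreover have "H x = - (Tn n - scal_op z) (G (S n x)) - F n x"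
      unfolding H_def by (simp only: blinfun.diff_left[of "- _"] blinfun.minus_left blinfun_apply_blinfun_compose)
    ultimately have "(W + H) x = (Tn n - scal_op z) x - S n x - F n x"
      by (simp only: blinfun.add_left[of W]) simp
    also have "\<dots> = (T - scal_op z) x" by (simp add: SF(3) blinfun.add_left blinfun.diff_left)
    finally show "(T - scal_op z) x = (W + H) x" by simp
  qed
  ultimately show ?thesis using W by (auto simp: index_zero_def)
qed

end

text \<open>Only the invertible part is perturbed, the finite-rank part being kept. Openness makes
  the truncated \<open>sigma_sf T\<close> compact in the component argument.\<close>

lemma open_index_zero: "open {w. index_zero (T - scal_op w)}"
  unfolding open_dist
proof (intro ballI)
  fix w assume "w \<in> {w. index_zero (T - scal_op w)}"
  then obtain W V F where WV: "inverse_ops W V" and F: "finite_rank F" and eq: "T - scal_op w = W + F"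
    by (auto simp: index_zero_def)
  show "\<exists>e>0. \<forall>y. dist y w < e \<longrightarrow> y \<in> {w. index_zero (T - scal_op w)}"
  proof (intro exI[of _ "1 / (2 * (norm V + 1))"] conjI allI impI)
    show "0 < 1 / (2 * (norm V + 1))" by (simp add: add_nonneg_pos)
    fix y assume y: "dist y w < 1 / (2 * (norm V + 1))"
    let ?D = "scal_op (w - y) :: 'a \<Rightarrow>\<^sub>L 'a"
    have "norm ?D \<le> 1 / (2 * (norm V + 1))"
      using norm_scal_op_le[where 'a = 'a and c = "w - y"] y by (simp add: dist_norm norm_minus_commute)
    then have "norm ?D * norm V \<le> 1 / (2 * (norm V + 1)) * norm V" by (rule mult_right_mono) simp
    also have "\<dots> \<le> 1/2" by (rule quotient_le_half) simp
    finally obtain V' where "inverse_ops (W + ?D) V'" using inverse_ops_perturb[OF WV clinear_op_scal] by metis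
    moreover have "T - scal_op y = (T - scal_op w) + ?D" by (simp add: scal_op_diff)
    then have "T - scal_op y = (W + ?D) + F" by (simp add: eq)
    ultimately show "y \<in> {w. index_zero (T - scal_op w)}" using F by (auto simp: index_zero_def)
  qed
qed

section \<open>Lower semicontinuity of the spectrum\<close>

context fredholm_nu_approximation
begin

lemma spectrum_meets_ball:
  assumes lim0: "0 islimpt spectrum_op T"
    and comp: "\<forall>l \<in> spectrum_op T - closure (rho_sf_pm T). \<forall>\<epsilon>>0.
           \<exists>z \<in> sigma_sf T \<union> pi0 T.
             connected_component_set (sigma_sf T \<union> pi0 T) z \<subseteq> ball l \<epsilon>"
    and l: "l \<in> spectrum_op T" and e: "0 < e"
  shows "\<exists>n. spectrum_op (Tn n) \<inter> ball l e \<noteq> {}"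
proof (rule ccontr)
  assume "\<not> ?thesis"
  then have gap: "\<And>n w. w \<in> ball l e \<Longrightarrow> w \<notin> spectrum_op (Tn n)" by blast
  \<comment> \<open>In the gap \<open>T - scal_op w\<close> is a limit of index-zero operators, so
    being semi-Fredholm there amounts to \<open>index_zero\<close>.\<close>
  have sf: "semi_fredholm (shift_op T w) \<longleftrightarrow> index_zero (T - scal_op w)"
    and ix: "semi_fredholm (shift_op T w) \<Longrightarrow> index_op (shift_op T w) = 0" if "w \<in> ball l e" for w
    using semi_fredholm_index_zero_limit[OF index_zero_limit_of_invertible[OF gap[OF that]]]
      index_zero_semi_fredholm[of "T - scal_op w"] by (auto simp: shift_op_eq)
  have "l \<notin> closure (rho_sf_pm T)"
  proof
    assume "l \<in> closure (rho_sf_pm T)"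
    then obtain w where "w \<in> rho_sf_pm T" "w \<in> ball l e"
      using e unfolding closure_approachable by (metis dist_commute mem_ball)
    then show False using ix[of w] by (simp add: rho_sf_pm_def)
  qed
  then obtain z where z: "z \<in> sigma_sf T \<union> pi0 T"
    and comp_z: "connected_component_set (sigma_sf T \<union> pi0 T) z \<subseteq> ball l (e / 2)"
    using comp l e by (metis DiffI half_gt_zero)
  have zl: "z \<in> ball l (e / 2)" using comp_z z by (meson connected_component_refl mem_Collect_eq subsetD)
  show False
  proof (cases "z \<in> pi0 T")
    case True
    \<comment> \<open>Points of \<open>pi0 T\<close> are isolated in the spectrum, and 0 is
      not.\<close>
    then have "z \<noteq> 0" "\<not> z islimpt spectrum_op T" using lim0 by (auto simp: pi0_def)
    moreover obtain x where "x \<noteq> 0" "T x = scaleC z x"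
      using True by (auto simp: pi0_def kernel_def shift_op_def)
    ultimately obtain n where "spectrum_op (Tn n) \<inter> ball z (e / 2) \<noteq> {}"
      using isolated_eigenvalue_persists e by (metis half_gt_zero)
    then obtain w where w: "w \<in> spectrum_op (Tn n)" "dist z w < e / 2" by auto
    then have "w \<in> ball l e" using zl dist_triangle[of l w z] by simp
    with gap w(1) show False by blast
  next
    case False
    \<comment> \<open>Truncation to a closed ball inside the gap makes the set compact; the radius
      \<open>e / 2\<close> matches the ball that contains the component.\<close>
    define S where "S = sigma_sf T \<inter> cball l (e / 2)"
    have S_eq: "S = cball l (e / 2) - {w. index_zero (T - scal_op w)}"
      using sf e by (auto simp: S_def sigma_sf_def)
    have cS: "compact S" unfolding S_eq by (intro compact_diff compact_cball open_index_zero)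
    have zS: "z \<in> S" using False z zl by (auto simp: S_def)
    define C where "C = connected_component_set S z"
    have C: "C \<in> components S" using zS by (auto simp: C_def components_def)
    have "C \<subseteq> connected_component_set (sigma_sf T \<union> pi0 T) z"
      unfolding C_def by (rule connected_component_mono) (auto simp: S_def)
    then have "C \<subseteq> ball l (e / 2)" using comp_z by blast
    \<comment> \<open>By the Sura-Bura theorem a component of a compact set has arbitrarily small
      compact, relatively open neighbourhoods.\<close>
    then obtain K where K: "openin (top_of_set S) K" "compact K" "C \<subseteq> K" "K \<subseteq> ball l (e / 2)"
      using Sura_Bura_clopen_subset[OF closed_imp_locally_compact[OF compact_imp_closed[OF cS]] C
          compact_components[OF cS C] open_ball] by blast
    define G where "G = ball l (e / 2) - (S - K)"
    have "closedin (top_of_set S) (S - K)" using K(1) by (simp add: closedin_diff)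
    then have "closed (S - K)" using closedin_closed_trans[OF _ compact_imp_closed[OF cS]] by blast
    then have "open G" unfolding G_def by (intro open_Diff open_ball)
    moreover have "K \<subseteq> G" using K(4) by (auto simp: G_def)
    ultimately obtain d where d: "0 < d" "(\<Union>x\<in>K. ball x d) \<subseteq> G"
      using compact_subset_open_imp_ball_epsilon_subset[OF K(2)] by blast
    \<comment> \<open>The radius \<open>d / 2\<close> keeps the closure inside \<open>G\<close>. The
      frontier of \<open>V\<close> misses \<open>S\<close>: \<open>G\<close> excludes
      \<open>S - K\<close>, and \<open>K\<close> lies in the open set \<open>V\<close>.\<close>
    define V where "V = (\<Union>x\<in>K. ball x (d / 2))"
    have clV: "closure V \<subseteq> G"
    proof
      fix y assume "y \<in> closure V"
      then obtain v where v: "v \<in> V" "dist v y < d / 2" using d(1) unfolding closure_approachable by (metis half_gt_zero)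
      then obtain x where x: "x \<in> K" "dist x v < d / 2" by (auto simp: V_def)
      have "dist x y < d" using dist_triangle[of x y v] x(2) v(2) by simp
      then have "y \<in> (\<Union>x\<in>K. ball x d)" using x(1) by auto
      then show "y \<in> G" using d(2) by blast
    qed
    have Gl: "G \<subseteq> ball l e" using e by (auto simp: G_def)
    have KV: "K \<subseteq> V" using d(1) by (auto simp: V_def)
    have oV: "open V" by (auto simp: V_def)
    have "index_zero (T - scal_op z)"
    proof (rule index_zero_inside[OF oV])
      have "V \<subseteq> ball l (e / 2)" using clV closure_subset[of V] by (auto simp: G_def)
      then show "bounded V" by (rule bounded_subset[OF bounded_ball])
      show "closure V \<inter> spectrum_op (Tn n) = {}" for n using gap clV Gl by blast
      have "z \<in> C" unfolding C_def using zS by (simp add: connected_component_refl)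
      then show "z \<in> V" using KV K(3) by blast
      fix w assume "w \<in> frontier V"
      then have w: "w \<in> G" "w \<notin> V" using clV oV by (auto simp: frontier_def interior_open)
      then have "w \<notin> S" using KV by (auto simp: G_def)
      moreover have "w \<in> cball l (e / 2)" using w(1) by (auto simp: G_def)
      ultimately show "index_zero (T - scal_op w)" by (auto simp: S_eq)
    qed
    then show False using zS by (simp add: S_eq)
  qed
qed

end

section \<open>Convergence in the Hausdorff distance\<close>

lemma fredholm_nu_approximation_subseq:
  assumes "fredholm_nu_approximation T Tn" "strict_mono r"
  shows "fredholm_nu_approximation T (\<lambda>n. Tn (r n))"
  using assms nu_approximation_subseq
  by (auto simp: fredholm_nu_approximation_def)

text \<open>Nonemptiness and the uniform bound give the real suprema their meaning; without them
  \<open>SUP\<close> could be an arbitrary value.\<close>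

lemma hausdist_bounds:
  assumes "A \<noteq> {}" "B \<noteq> {}" "\<And>a. a \<in> A \<Longrightarrow> infdist a B \<le> e" "\<And>b. b \<in> B \<Longrightarrow> infdist b A \<le> e"
  shows "0 \<le> hausdist A B" "hausdist A B \<le> e"
proof -
  obtain a where a: "a \<in> A" using assms(1) by blast
  have "0 \<le> infdist a B" by (rule infdist_nonneg)
  also have "\<dots> \<le> (SUP a\<in>A. infdist a B)"
    by (rule cSUP_upper[OF a]) (use assms(3) in \<open>auto intro!: bdd_aboveI2\<close>)
  finally show "0 \<le> hausdist A B" by (simp add: hausdist_def)
  show "hausdist A B \<le> e" unfolding hausdist_def using assms by (auto intro!: cSUP_least)
qed

theorem theorem3p2:
  fixes T :: "'a::cbanach \<Rightarrow>\<^sub>L 'a"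
  assumes "clinear_op T"
    and "fredholm (blinfun_apply T)"
    and "0 islimpt spectrum_op T"
    and "\<forall>l \<in> spectrum_op T - closure (rho_sf_pm T). \<forall>\<epsilon>>0.
           \<exists>z \<in> sigma_sf T \<union> pi0 T.
             connected_component_set (sigma_sf T \<union> pi0 T) z \<subseteq> ball l \<epsilon>"
  shows "\<forall>Tn. (\<forall>n. clinear_op (Tn n)) \<and> nu_conv Tn T \<longrightarrow>
           (\<lambda>n. hausdist (spectrum_op (Tn n)) (spectrum_op T)) \<longlonglongrightarrow> 0"
proof (intro allI impI, elim conjE)
  fix Tn :: "nat \<Rightarrow> 'a \<Rightarrow>\<^sub>L 'a"
  assume "\<forall>n. clinear_op (Tn n)" "nu_conv Tn T"
  then interpret fredholm_nu_approximation T Tn using assms(1,2) by unfold_locales auto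
  \<comment> \<open>This makes the spectrum nonempty, and keeps 0 out of the compact sets on which
    resolvents are bounded.\<close>
  have T0: "0 \<in> spectrum_op T" using assms(3) closed_spectrum[OF T] closed_limpt by blast
  have cT: "compact (spectrum_op T)"
    using closed_spectrum[OF T] norm_spectrum_le[OF T] by (auto simp: compact_eq_bounded_closed bounded_iff)
  \<comment> \<open>If infinitely many spectra missed the ball, a subsequence would miss it
    altogether, contradicting \<open>spectrum_meets_ball\<close>.\<close>
  have lower: "eventually (\<lambda>n. spectrum_op (Tn n) \<inter> ball l e \<noteq> {}) sequentially"
    if l: "l \<in> spectrum_op T" and e: "0 < e" for l e
  proof (rule ccontr)
    assume "\<not> ?thesis"
    then obtain r :: "nat \<Rightarrow> nat" where r: "strict_mono r" "\<And>n. \<not> spectrum_op (Tn (r n)) \<inter> ball l e \<noteq> {}"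
      using not_eventually_sequentiallyD by blast
    interpret sub: fredholm_nu_approximation T "\<lambda>n. Tn (r n)"
      by (rule fredholm_nu_approximation_subseq[OF fredholm_nu_approximation_axioms r(1)])
    show False using sub.spectrum_meets_ball[OF assms(3,4) l e] r(2) by blast
  qed
  show "(\<lambda>n. hausdist (spectrum_op (Tn n)) (spectrum_op T)) \<longlonglongrightarrow> 0"
  proof (rule tendstoI)
    fix e :: real assume e: "0 < e"
    \<comment> \<open>The suprema are bounded by \<open>h\<close> only weakly, so half of
      \<open>e\<close> is kept in reserve.\<close>
    define h where "h = e / 2"
    have h: "0 < h" "h < e" using e by (auto simp: h_def)
    \<comment> \<open>A finite net turns pointwise lower semicontinuity into a uniform statement;
      both halves of \<open>h\<close> are used in the triangle inequality.\<close>
    obtain L where L: "L \<subseteq> spectrum_op T" "finite L" "spectrum_op T \<subseteq> (\<Union>l\<in>L. ball l (h / 2))"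
    proof (rule compactE_image[OF cT])
      show "spectrum_op T \<subseteq> (\<Union>l\<in>spectrum_op T. ball l (h / 2))" using h(1) by auto
    qed auto
    have "eventually (\<lambda>n. \<forall>l\<in>L. spectrum_op (Tn n) \<inter> ball l (h / 2) \<noteq> {}) sequentially"
      using L(1) h(1) by (intro eventually_ball_finite[OF L(2)] ballI lower) auto
    then have ev1: "eventually (\<lambda>n. \<forall>b\<in>spectrum_op T. spectrum_op (Tn n) \<noteq> {} \<and> infdist b (spectrum_op (Tn n)) \<le> h) sequentially"
    proof eventually_elim
      case (elim n)
      show ?case
      proof
        fix b assume "b \<in> spectrum_op T"
        then obtain l where l: "l \<in> L" "dist l b < h / 2" using L(3) by auto
        then obtain a where a: "a \<in> spectrum_op (Tn n)" "dist l a < h / 2" using elim by fastforce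
        have "infdist b (spectrum_op (Tn n)) \<le> dist b a" by (rule infdist_le[OF a(1)])
        also have "\<dots> \<le> h" using dist_triangle[of b a l] l(2) a(2) by (simp add: dist_commute)
        finally show "spectrum_op (Tn n) \<noteq> {} \<and> infdist b (spectrum_op (Tn n)) \<le> h" using a(1) by blast
      qed
    qed
    obtain M where M: "0 < M" "\<And>n. norm (Tn n) \<le> M" using norm_bound by blast
    \<comment> \<open>The disc contains the spectra of all \<open>Tn n\<close>, so any of their
      points farther than \<open>h\<close> from \<open>spectrum_op T\<close> would lie in this
      compact set.\<close>
    define K where "K = cball 0 (2 * M) \<inter> {w. h \<le> infdist w (spectrum_op T)}"
    have "closed {w. h \<le> infdist w (spectrum_op T)}"
      by (intro closed_Collect_le continuous_intros)
    then have "compact K" unfolding K_def by (intro compact_Int_closed compact_cball)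
    moreover have "K \<inter> spectrum_op T = {}" using h(1) by (auto simp: K_def)
    moreover from this have "0 \<notin> K" using T0 by blast
    ultimately obtain N where N: "\<And>n w. N \<le> n \<Longrightarrow> w \<in> K \<Longrightarrow> w \<notin> spectrum_op (Tn n)"
      using resolvent_uniformly_bounded by metis
    have ev2: "eventually (\<lambda>n. \<forall>a\<in>spectrum_op (Tn n). infdist a (spectrum_op T) \<le> h) sequentially"
      using eventually_ge_at_top[of N]
    proof eventually_elim
      case (elim n)
      show ?case
      proof (rule ballI, rule ccontr)
        fix a assume a: "a \<in> spectrum_op (Tn n)" "\<not> infdist a (spectrum_op T) \<le> h"
        have "cmod a \<le> 2 * M" using norm_spectrum_le[OF Tn a(1)] M(2)[of n] by linarith
        then have "a \<in> K" using a(2) by (simp add: K_def)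
        with N[OF elim] a(1) show False by blast
      qed
    qed
    from ev1 ev2
    show "eventually (\<lambda>n. dist (hausdist (spectrum_op (Tn n)) (spectrum_op T)) 0 < e) sequentially"
    proof eventually_elim
      case (elim n)
      have "0 \<le> hausdist (spectrum_op (Tn n)) (spectrum_op T)" "hausdist (spectrum_op (Tn n)) (spectrum_op T) \<le> h"
        using hausdist_bounds[of "spectrum_op (Tn n)" "spectrum_op T" h] elim T0 by blast+
      then show ?case using h(2) by (simp add: dist_real_def)
    qed
  qed
qed

end
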